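(* Let $K$ be any field. The Lie superalgebra $\mathbf Q=\mathrm{Lie}(v_0,v_1,v_2)$ is just infinite, i.e. it is infinite-dimensional and every nonzero ideal of $\mathbf Q$ has finite codimension in $\mathbf Q$.
   Context: $\Lambda$ is the Grassmann algebra over $K$ on odd generators $x_0,x_1,\dots$; $x_i$ is identified with left multiplication; $\partial_i$ is the odd superderivation with $\partial_i(x_j)=\delta_{ij}$; pivot elements $v_i=\sum_{k\ge0}\big(\prod_{n=0}^{k-1}x_{i+3n}x_{i+3n+1}\big)\partial_{i+3k}$, $i\ge0$. $\mathbf Q$ is the Lie subsuperalgebra of $(\operatorname{End}\Lambda)^{(-)}$ (supercommutator $[a,b]=ab-(-1)^{|a||b|}ba$) generated by $v_0,v_1,v_2$; in characteristic $2$ it is also closed under squaring of odd elements. *)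

theory Defs
  imports Main HOL.Modules "HOL-Library.FSet" "HOL-Library.Function_Algebras"
begin

text \<open>
  Conventions.  The Grassmann algebra Lambda over the field 'a on odd generators x_0, x_1, ...
  has K-basis the monomials x_S = x_{s_1} x_{s_2} ... x_{s_m} with S = {s_1 < ... < s_m}
  a finite set of naturals (type nat fset).  A K-linear endomorphism E of Lambda is encoded
  by its (column-finite) matrix: E S T is the coefficient of x_T in E(x_S).
  Composition ecomp E F is "first F, then E".
\<close>

type_synonym 'a endo = "nat fset \<Rightarrow> nat fset \<Rightarrow> 'a"

definition ecomp :: "'a::field endo \<Rightarrow> 'a endo \<Rightarrow> 'a endo" where
  "ecomp E F = (\<lambda>S U. \<Sum>T\<in>{T. F S T \<noteq> 0}. F S T * E T U)"

definition eid :: "'a::field endo" where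
  "eid = (\<lambda>S T. if S = T then 1 else 0)"

definition escale :: "'a::field \<Rightarrow> 'a endo \<Rightarrow> 'a endo" where
  "escale c E = (\<lambda>S T. c * E S T)"

text \<open>Left multiplication by x_i: x_i x_S = (-1)^{#{s in S. s < i}} x_{S + {i}} if i notin S, else 0.\<close>
definition lmul :: "nat \<Rightarrow> 'a::field endo" where
  "lmul i = (\<lambda>S T. if i |\<notin>| S \<and> T = finsert i S
                     then (-1) ^ card {s. s |\<in>| S \<and> s < i} else 0)"

text \<open>The odd superderivation partial_i with partial_i(x_j) = delta_ij:
  partial_i(x_S) = (-1)^{#{s in S. s < i}} x_{S - {i}} if i in S, else 0.\<close>
definition pder :: "nat \<Rightarrow> 'a::field endo" where
  "pder i = (\<lambda>S T. if i |\<in>| S \<and> T = S |-| {|i|}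
                     then (-1) ^ card {s. s |\<in>| S \<and> s < i} else 0)"

fun pw :: "nat \<Rightarrow> nat \<Rightarrow> 'a::field endo" where
  "pw i 0 = eid"
| "pw i (Suc k) = ecomp (pw i k) (ecomp (lmul (i + 3 * k)) (lmul (i + 3 * k + 1)))"

text \<open>Pivot element v_i = sum_{k>=0} (prod_{n<k} x_{i+3n} x_{i+3n+1}) partial_{i+3k}.
  Applied to x_S only the (finitely many) terms with i+3k in S are nonzero.\<close>
definition pivot :: "nat \<Rightarrow> 'a::field endo" where
  "pivot i = (\<lambda>S U. \<Sum>k\<in>{k. i + 3 * k |\<in>| S}. ecomp (pw i k) (pder (i + 3 * k)) S U)"

definition even_part :: "'a::field endo \<Rightarrow> 'a endo" where
  "even_part E = (\<lambda>S T. if even (fcard S + fcard T) then E S T else 0)"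

definition odd_part :: "'a::field endo \<Rightarrow> 'a endo" where
  "odd_part E = (\<lambda>S T. if odd (fcard S + fcard T) then E S T else 0)"

definition is_odd :: "'a::field endo \<Rightarrow> bool" where
  "is_odd E \<longleftrightarrow> even_part E = 0"

text \<open>Supercommutator, extended bilinearly from homogeneous elements.\<close>
definition sbr :: "'a::field endo \<Rightarrow> 'a endo \<Rightarrow> 'a endo" where
  "sbr a b =
     (ecomp (even_part a) b - ecomp b (even_part a))
   + (ecomp (odd_part a) (even_part b) - ecomp (even_part b) (odd_part a))
   + (ecomp (odd_part a) (odd_part b) + ecomp (odd_part b) (odd_part a))"

inductive_set Qalg :: "'a::field endo set" where
  gen: "j < 3 \<Longrightarrow> pivot j \<in> Qalg"
| zero: "0 \<in> Qalg"
| add: "a \<in> Qalg \<Longrightarrow> b \<in> Qalg \<Longrightarrow> a + b \<in> Qalg"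
| scale: "a \<in> Qalg \<Longrightarrow> escale c a \<in> Qalg"
| br: "a \<in> Qalg \<Longrightarrow> b \<in> Qalg \<Longrightarrow> sbr a b \<in> Qalg"
| sq: "(1::'a) + 1 = 0 \<Longrightarrow> a \<in> Qalg \<Longrightarrow> is_odd a \<Longrightarrow> ecomp a a \<in> Qalg"

definition is_ideal :: "'a::field endo set \<Rightarrow> bool" where
  "is_ideal I \<longleftrightarrow> I \<subseteq> Qalg \<and> module.subspace escale I
     \<and> (\<forall>a\<in>I. even_part a \<in> I \<and> odd_part a \<in> I)
     \<and> (\<forall>q\<in>Qalg. \<forall>a\<in>I. sbr q a \<in> I)
     \<and> ((1::'a) + 1 = 0 \<longrightarrow> (\<forall>a\<in>I. is_odd a \<longrightarrow> ecomp a a \<in> I))"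

definition fin_codim :: "'a::field endo set \<Rightarrow> 'a endo set \<Rightarrow> bool" where
  "fin_codim I V \<longleftrightarrow> (\<exists>F. finite F \<and> V \<subseteq> module.span escale (I \<union> F))"

definition infinite_dim :: "'a::field endo set \<Rightarrow> bool" where
  "infinite_dim V \<longleftrightarrow> \<not> (\<exists>F. finite F \<and> V \<subseteq> module.span escale F)"

end

theory Submission
  imports Defs HOL.Vector_Spaces
begin

text \<open>
  From \<open>v\<^sub>i = \<partial>\<^sub>i + x\<^sub>i x\<^bsub>i+1\<^esub> v\<^bsub>i+3\<^esub>\<close> one gets
  \<open>v\<^sub>i\<^sup>2 = x\<^bsub>i+1\<^esub> v\<^bsub>i+3\<^esub>\<close>,
  \<open>[v\<^sub>i, v\<^bsub>i+1\<^esub>] = - x\<^sub>i v\<^bsub>i+3\<^esub>\<close>,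
  \<open>[v\<^sub>i, v\<^bsub>i+2\<^esub>] = - x\<^sub>i x\<^bsub>i+1\<^esub> x\<^bsub>i+2\<^esub> v\<^bsub>i+5\<^esub>\<close> and
  \<open>[v\<^sub>n, v\<^sub>m] = x\<^sub>n x\<^bsub>n+1\<^esub> [v\<^bsub>n+3\<^esub>, v\<^sub>m]\<close> for \<open>m \<ge> n + 3\<close>.
  Hence brackets of monomials \<open>x\<^sub>S v\<^sub>m\<close> are scalar multiples of monomials, and Q is spanned by
  monomials with \<open>S\<close> contained in \<open>{0..m-2}\<close>. Bracketing with \<open>v\<^sub>n\<close> deletes \<open>x\<^sub>n\<close>, so the set of
  \<open>S\<close> with \<open>x\<^sub>S v\<^sub>m\<close> in a given ideal is closed under subsets, and it suffices to produce large \<open>S\<close>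
  by the bracket formulas. In this way an ideal that contains all \<open>v\<^sub>n\<close> with \<open>n \<ge> N\<close> contains all
  spanning monomials with \<open>m \<ge> N + 15\<close>.

  Given a nonzero element of an ideal, deleting the variables of its coefficient at the lowest pivot in
  descending order leaves \<open>v\<^sub>m\<close> plus terms \<open>x\<^sub>S v\<^sub>n\<close> with \<open>n > m\<close>. The bracket with
  \<open>x\<^sub>m v\<^sub>p\<close>, for large \<open>p\<close>, gives \<open>v\<^sub>p\<close> plus terms divisible by \<open>x\<^bsub>p-3\<^esub>\<close> or
  \<open>x\<^bsub>p-2\<^esub>\<close>; these are killed by the bracket with
  \<open>x\<^bsub>p-3\<^esub> x\<^bsub>p-2\<^esub> x\<^sub>p v\<^bsub>p+3\<^esub>\<close>, and what remains yields \<open>v\<^bsub>p+3\<^esub>\<close>.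
\<close>

section \<open>The ring of column-finite operators\<close>

text \<open>An infinite index set makes the sum in \<open>ecomp\<close> 0 by convention, so
  associativity can fail without this restriction.\<close>

definition col_finite :: "'a::field endo \<Rightarrow> bool" where
  "col_finite E \<longleftrightarrow> (\<forall>S. finite {T. E S T \<noteq> 0})"

lemma col_finiteI:
  assumes "\<And>S T. E S T \<noteq> 0 \<Longrightarrow> T \<in> A S" and "\<And>S. finite (A S)"
  shows "col_finite E"
  unfolding col_finite_def
proof
  fix S
  have "{T. E S T \<noteq> 0} \<subseteq> A S" using assms(1) by blast
  then show "finite {T. E S T \<noteq> 0}" using assms(2) finite_subset by blast
qed

lemma ecomp_eq_sum:
  assumes "finite A" and "\<And>T. F S T \<noteq> 0 \<Longrightarrow> T \<in> A"
  shows "ecomp E F S U = (\<Sum>T\<in>A. F S T * E T U)"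
  unfolding ecomp_def using assms by (intro sum.mono_neutral_left) auto

lemma ecomp_single:
  assumes "\<And>T. F S T \<noteq> 0 \<Longrightarrow> T = V"
  shows "ecomp E F S U = F S V * E V U"
  using assms by (subst ecomp_eq_sum[where A="{V}"]) auto

lemma col_finite_ecomp:
  assumes "col_finite E" "col_finite F"
  shows "col_finite (ecomp E F)"
proof (rule col_finiteI[where A="\<lambda>S. \<Union>T\<in>{T. F S T \<noteq> 0}. {U. E T U \<noteq> 0}"])
  fix S U assume "ecomp E F S U \<noteq> 0"
  then obtain T where "F S T \<noteq> 0" "F S T * E T U \<noteq> 0"
    unfolding ecomp_def by (metis (mono_tags, lifting) sum.neutral mem_Collect_eq)
  then show "U \<in> (\<Union>T\<in>{T. F S T \<noteq> 0}. {U. E T U \<noteq> 0})" by auto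
qed (use assms in \<open>auto simp: col_finite_def\<close>)

lemma col_finite_0: "col_finite 0"
  by (rule col_finiteI[where A="\<lambda>_. {}"]) auto

lemma col_finite_eid: "col_finite eid"
  by (rule col_finiteI[where A="\<lambda>S. {S}"]) (auto simp: eid_def split: if_splits)

lemma col_finite_add:
  assumes "col_finite E" "col_finite F" shows "col_finite (E + F)"
  by (rule col_finiteI[where A="\<lambda>S. {T. E S T \<noteq> 0} \<union> {T. F S T \<noteq> 0}"])
     (use assms in \<open>auto simp: col_finite_def\<close>)

lemma col_finite_uminus:
  assumes "col_finite E" shows "col_finite (- E)"
  by (rule col_finiteI[where A="\<lambda>S. {T. E S T \<noteq> 0}"]) (use assms in \<open>auto simp: col_finite_def\<close>)

lemma col_finite_diff:
  assumes "col_finite E" "col_finite F" shows "col_finite (E - F)"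
  by (rule col_finiteI[where A="\<lambda>S. {T. E S T \<noteq> 0} \<union> {T. F S T \<noteq> 0}"])
     (use assms in \<open>auto simp: col_finite_def\<close>)

lemma col_finite_escale:
  assumes "col_finite E" shows "col_finite (escale c E)"
  by (rule col_finiteI[where A="\<lambda>S. {T. E S T \<noteq> 0}"])
     (use assms in \<open>auto simp: col_finite_def escale_def\<close>)

lemma col_finite_even_part:
  assumes "col_finite E" shows "col_finite (even_part E)"
  by (rule col_finiteI[where A="\<lambda>S. {T. E S T \<noteq> 0}"])
     (use assms in \<open>auto simp: col_finite_def even_part_def split: if_splits\<close>)

lemma col_finite_odd_part:
  assumes "col_finite E" shows "col_finite (odd_part E)"
  by (rule col_finiteI[where A="\<lambda>S. {T. E S T \<noteq> 0}"])
     (use assms in \<open>auto simp: col_finite_def odd_part_def split: if_splits\<close>)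

lemma col_finite_lmul: "col_finite (lmul i)"
  by (rule col_finiteI[where A="\<lambda>S. {finsert i S}"]) (auto simp: lmul_def split: if_splits)

lemma col_finite_pder: "col_finite (pder i)"
  by (rule col_finiteI[where A="\<lambda>S. {S |-| {|i|}}"]) (auto simp: pder_def split: if_splits)

lemma col_finite_pw: "col_finite (pw i k)"
  by (induction k) (auto intro: col_finite_eid col_finite_ecomp col_finite_lmul)

lemma finite_pivot_index: "finite {k::nat. i + 3 * k |\<in>| S}"
proof (rule finite_subset)
  show "{k. i + 3 * k |\<in>| S} \<subseteq> {..fMax S}"
  proof safe
    fix k assume "i + 3 * k |\<in>| S"
    then have "i + 3 * k \<le> fMax S" by simp
    then show "k \<le> fMax S" by simp
  qed
qed simp

lemma col_finite_pivot: "col_finite (pivot i)"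
proof (rule col_finiteI[where A="\<lambda>S. \<Union>k\<in>{k. i + 3 * k |\<in>| S}.
    {U. ecomp (pw i k) (pder (i + 3 * k)) S U \<noteq> 0}"])
  fix S U assume "pivot i S U \<noteq> (0::'a)"
  then show "U \<in> (\<Union>k\<in>{k. i + 3 * k |\<in>| S}.
      {U. ecomp (pw i k) (pder (i + 3 * k)) S U \<noteq> (0::'a)})"
    unfolding pivot_def by (auto elim: sum.not_neutral_contains_not_neutral)
next
  fix S
  have "col_finite (ecomp (pw i k) (pder (i + 3 * k)) :: 'a endo)" for k
    by (intro col_finite_ecomp col_finite_pw col_finite_pder)
  then show "finite (\<Union>k\<in>{k. i + 3 * k |\<in>| S}.
      {U. ecomp (pw i k) (pder (i + 3 * k)) S U \<noteq> (0::'a)})"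
    using finite_pivot_index unfolding col_finite_def by blast
qed

lemma ecomp_assoc:
  assumes "col_finite F" "col_finite G"
  shows "ecomp (ecomp E F) G = ecomp E (ecomp F G)"
proof (intro ext)
  fix S U
  let ?A = "{T. G S T \<noteq> 0}"
  \<comment> \<open>\<open>?B\<close> contains every monomial reached from \<open>S\<close> by
    \<open>G\<close> and then \<open>F\<close>. As a common finite index set for the inner sums it
    permits the interchange of summation.\<close>
  let ?B = "\<Union>T\<in>?A. {V. F T V \<noteq> 0}"
  have fin: "finite ?A" "finite ?B" using assms by (auto simp: col_finite_def)
  have "ecomp (ecomp E F) G S U = (\<Sum>T\<in>?A. G S T * (\<Sum>V\<in>?B. F T V * E V U))"
    unfolding ecomp_def[of "ecomp E F"]
    by (intro sum.cong refl arg_cong2[where f="(*)"] ecomp_eq_sum) (use fin in auto)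
  also have "\<dots> = (\<Sum>V\<in>?B. (\<Sum>T\<in>?A. G S T * F T V) * E V U)"
    by (simp add: sum_distrib_left sum_distrib_right mult.assoc) (rule sum.swap)
  also have "\<dots> = (\<Sum>V\<in>?B. ecomp F G S V * E V U)"
    unfolding ecomp_def by simp
  also have "\<dots> = ecomp E (ecomp F G) S U"
  proof (rule ecomp_eq_sum[symmetric])
    fix T assume "ecomp F G S T \<noteq> 0"
    then obtain V where "G S V \<noteq> 0" "G S V * F V T \<noteq> 0"
      unfolding ecomp_def by (metis (mono_tags, lifting) sum.neutral mem_Collect_eq)
    then show "T \<in> ?B" by auto
  qed (use fin in auto)
  finally show "ecomp (ecomp E F) G S U = ecomp E (ecomp F G) S U" .
qed

lemma ecomp_add_left: "ecomp (E + F) G = ecomp E G + ecomp F G"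
  by (intro ext) (simp add: ecomp_def sum.distrib algebra_simps)

lemma ecomp_add_right:
  assumes "col_finite F" "col_finite G"
  shows "ecomp E (F + G) = ecomp E F + ecomp E G"
proof (intro ext)
  fix S U
  let ?A = "{T. F S T \<noteq> 0} \<union> {T. G S T \<noteq> 0}"
  have "finite ?A" using assms by (auto simp: col_finite_def)
  then have "ecomp E (F + G) S U = (\<Sum>T\<in>?A. (F + G) S T * E T U)"
    "ecomp E F S U = (\<Sum>T\<in>?A. F S T * E T U)"
    "ecomp E G S U = (\<Sum>T\<in>?A. G S T * E T U)"
    by (intro ecomp_eq_sum; auto)+
  then show "ecomp E (F + G) S U = (ecomp E F + ecomp E G) S U"
    by (simp add: sum.distrib algebra_simps)
qed

text \<open>A type of its own turns composition into multiplication in a ring, so that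
  \<open>algebra_simps\<close> applies. That \<open>Qalg\<close> lies in its range is part of
  \<open>Qalg_filt\<close>.\<close>

typedef (overloaded) 'a op = "{E :: 'a::field endo. col_finite E}"
  morphisms mat Op
  using col_finite_0 by blast

setup_lifting type_definition_op

instantiation op :: (field) ring_1
begin
lift_definition zero_op :: "'a op" is 0 by (rule col_finite_0)
lift_definition one_op :: "'a op" is eid by (rule col_finite_eid)
lift_definition plus_op :: "'a op \<Rightarrow> 'a op \<Rightarrow> 'a op" is "(+)" by (rule col_finite_add)
lift_definition minus_op :: "'a op \<Rightarrow> 'a op \<Rightarrow> 'a op" is "(-)" by (rule col_finite_diff)
lift_definition uminus_op :: "'a op \<Rightarrow> 'a op" is uminus by (rule col_finite_uminus)
lift_definition times_op :: "'a op \<Rightarrow> 'a op \<Rightarrow> 'a op" is ecomp by (rule col_finite_ecomp)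
instance
proof
  fix a b c :: "'a op"
  show "a * b * c = a * (b * c)" by transfer (rule ecomp_assoc)
  show "(a + b) * c = a * c + b * c" by transfer (rule ecomp_add_left)
  show "a * (b + c) = a * b + a * c" by transfer (rule ecomp_add_right)
  show "1 * a = a"
  proof (transfer, intro ext)
    fix a :: "'a endo" and S U assume "col_finite a"
    then show "ecomp eid a S U = a S U"
      by (cases "a S U = 0") (auto simp: ecomp_def eid_def col_finite_def if_distrib cong: if_cong)
  qed
  show "a * 1 = a"
    by (transfer, intro ext, subst ecomp_single) (auto simp: eid_def split: if_splits)
  show "(0::'a op) \<noteq> 1"
    by transfer (auto simp: eid_def fun_eq_iff)
qed (transfer; simp add: algebra_simps)+
end

lift_definition scl :: "'a::field \<Rightarrow> 'a op \<Rightarrow> 'a op" is escale by (rule col_finite_escale)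
lift_definition ev :: "'a::field op \<Rightarrow> 'a op" is even_part by (rule col_finite_even_part)
lift_definition od :: "'a::field op \<Rightarrow> 'a op" is odd_part by (rule col_finite_odd_part)
lift_definition lx :: "nat \<Rightarrow> 'a::field op" is lmul by (rule col_finite_lmul)
lift_definition dd :: "nat \<Rightarrow> 'a::field op" is pder by (rule col_finite_pder)
lift_definition vv :: "nat \<Rightarrow> 'a::field op" is pivot by (rule col_finite_pivot)
lift_definition xprod :: "nat \<Rightarrow> nat \<Rightarrow> 'a::field op" is pw by (rule col_finite_pw)

lemma op_eqI: "(\<And>S U. mat a S U = mat b S U) \<Longrightarrow> a = b"
  by transfer auto

lemma mat_simps [simp]:
  "mat 0 S T = 0" "mat 1 S T = (if S = T then 1 else 0)"
  "mat (a + b) S T = mat a S T + mat b S T" "mat (a - b) S T = mat a S T - mat b S T"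
  "mat (- a) S T = - mat a S T" "mat (scl c a) S T = c * mat a S T"
  by (simp_all add: zero_op.rep_eq one_op.rep_eq plus_op.rep_eq minus_op.rep_eq uminus_op.rep_eq
      scl.rep_eq escale_def eid_def)

lemma mat_sum: "mat (sum f A) S U = (\<Sum>i\<in>A. mat (f i) S U)"
  by (induction A rule: infinite_finite_induct) auto

lemma finite_mat: "finite {T. mat a S T \<noteq> 0}"
  using mat[of a] by (simp add: col_finite_def)

lemma mat_times: "mat (a * b) S U = (\<Sum>T | mat b S T \<noteq> 0. mat b S T * mat a T U)"
  by (simp add: times_op.rep_eq ecomp_def)

lemma mat_times_single:
  assumes "\<And>T. mat b S T \<noteq> 0 \<Longrightarrow> T = V"
  shows "mat (a * b) S U = mat b S V * mat a V U"
  using ecomp_single[of "mat b"] assms by (simp add: times_op.rep_eq)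

lemma scl_mult_left [simp]: "scl c a * b = scl c (a * b)"
  by (rule op_eqI) (simp add: mat_times sum_distrib_left algebra_simps)

lemma scl_mult_right [simp]: "a * scl c b = scl c (a * b)"
proof (rule op_eqI)
  fix S U
  have "mat (a * scl c b) S U = (\<Sum>T | mat b S T \<noteq> 0. (c * mat b S T) * mat a T U)"
    unfolding times_op.rep_eq by (subst ecomp_eq_sum[OF finite_mat[of b S]]) auto
  then show "mat (a * scl c b) S U = mat (scl c (a * b)) S U"
    by (simp add: mat_times sum_distrib_left algebra_simps)
qed

lemma scl_simps [simp]:
  "scl 0 a = 0" "scl 1 a = a" "scl c 0 = 0" "scl c (scl c' a) = scl (c * c') a"
  "scl (- c) a = - scl c a" "scl c (- a) = - scl c a"
  by (auto intro!: op_eqI)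

lemma scl_add: "scl c (a + b) = scl c a + scl c b"
  and scl_add_left: "scl (c + c') a = scl c a + scl c' a"
  and scl_diff: "scl c (a - b) = scl c a - scl c b"
  by (auto intro!: op_eqI simp: algebra_simps)

interpretation op: module "scl :: 'a::field \<Rightarrow> 'a op \<Rightarrow> 'a op"
  by standard (auto simp: scl_add scl_add_left)

interpretation endo: vector_space "escale :: 'a::field \<Rightarrow> 'a endo \<Rightarrow> 'a endo"
  by standard (intro ext, simp add: escale_def algebra_simps)+

section \<open>Canonical anticommutation relations and the pivots\<close>

definition sg :: "nat \<Rightarrow> nat fset \<Rightarrow> 'a::field" where
  "sg i S = (-1) ^ card {s. s |\<in>| S \<and> s < i}"

lemma sg_finsert: "j |\<notin>| S \<Longrightarrow> sg i (finsert j S) = (if j < i then - sg i S else sg i S)"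
proof -
  assume "j |\<notin>| S"
  moreover have "{s. s |\<in>| finsert j S \<and> s < i} =
      (if j < i then insert j {s. s |\<in>| S \<and> s < i} else {s. s |\<in>| S \<and> s < i})" by auto
  ultimately show ?thesis by (simp add: sg_def)
qed

lemma sg_fminus: "j |\<in>| S \<Longrightarrow> (sg i (S |-| {|j|}) :: 'a::field) = (if j < i then - sg i S else sg i S)"
proof -
  assume "j |\<in>| S"
  then have "sg i S = (if j < i then - sg i (S |-| {|j|}) else sg i (S |-| {|j|}) :: 'a)"
    using sg_finsert[of j "S |-| {|j|}" i] by (simp add: finsert_absorb)
  then show ?thesis by simp
qed

lemma sg_sq [simp]: "sg i S * sg i S = 1"
  by (simp add: sg_def flip: power_add)

lemma mat_lx: "mat (lx i) S T = (if i |\<notin>| S \<and> T = finsert i S then sg i S else 0)"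
  by (simp add: lx.rep_eq lmul_def sg_def)

lemma mat_dd: "mat (dd i) S T = (if i |\<in>| S \<and> T = S |-| {|i|} then sg i S else 0)"
  by (simp add: dd.rep_eq pder_def sg_def)

lemma mat_times_lx: "mat (a * lx i) S U = (if i |\<in>| S then 0 else sg i S * mat a (finsert i S) U)"
  by (subst mat_times_single[where V="finsert i S"]) (auto simp: mat_lx split: if_splits)

lemma mat_times_dd: "mat (a * dd i) S U = (if i |\<in>| S then sg i S * mat a (S |-| {|i|}) U else 0)"
  by (subst mat_times_single[where V="S |-| {|i|}"]) (auto simp: mat_dd split: if_splits)

lemma lx_swap: "lx i * lx j = - (lx j * lx i)"
  by (rule op_eqI) (auto simp: mat_times_lx mat_lx sg_finsert finsert_commute)

lemma lx_sq [simp]: "lx i * lx i = 0"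
  by (rule op_eqI) (auto simp: mat_times_lx mat_lx)

lemma dd_swap: "dd i * dd j = - (dd j * dd i)"
proof (rule op_eqI)
  fix S U
  have "S |-| {|j|} |-| {|i|} = S |-| {|i|} |-| {|j|}" by blast
  then show "mat (dd i * dd j) S U = mat (- (dd j * dd i)) S U"
    by (cases "i = j") (auto simp: mat_times_dd mat_dd sg_fminus)
qed

lemma dd_sq [simp]: "dd i * dd i = 0"
  by (rule op_eqI) (auto simp: mat_times_dd mat_dd)

lemma dd_lx: assumes "i \<noteq> j" shows "dd i * lx j = - (lx j * dd i)"
proof (rule op_eqI)
  fix S U
  have "finsert j S |-| {|i|} = finsert j (S |-| {|i|})" using assms by auto
  with assms show "mat (dd i * lx j) S U = mat (- (lx j * dd i)) S U"
    by (auto simp: mat_times_dd mat_times_lx mat_dd mat_lx sg_fminus sg_finsert)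
qed

lemma dd_lx_same: "dd i * lx i = 1 - lx i * dd i"
proof (rule op_eqI)
  fix S U
  have "i |\<notin>| S \<Longrightarrow> finsert i S |-| {|i|} = S" "i |\<in>| S \<Longrightarrow> finsert i (S |-| {|i|}) = S" by auto
  then show "mat (dd i * lx i) S U = mat (1 - lx i * dd i) S U"
    by (auto simp: mat_times_dd mat_times_lx mat_dd mat_lx sg_fminus sg_finsert)
qed

section \<open>Finite truncations of the pivots and their recursion\<close>

lemma xprod_simps [simp]:
  "xprod i 0 = 1"
  "xprod i (Suc k) = xprod i k * (lx (i + 3 * k) * lx (i + 3 * k + 1))"
  by (transfer; simp)+

lemma xprod_Suc_left: "(xprod i (Suc k) :: 'a::field op) = lx i * lx (i + 1) * xprod (i + 3) k"
proof (induction k)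
  case (Suc k)
  have "(xprod i (Suc (Suc k)) :: 'a op) = xprod i (Suc k) * (lx (i + 3 + 3 * k) * lx (i + 3 + 3 * k + 1))"
    by (simp add: add_ac)
  also have "\<dots> = lx i * lx (i + 1) * xprod (i + 3) (Suc k)"
    unfolding Suc xprod_simps(2)[of "i + 3"] by (simp only: mult.assoc)
  finally show ?case .
qed simp

text \<open>A pivot is an infinite sum of operators; identities are proved for these partial sums
  and carried over by \<open>mat_vv\<close>.\<close>

definition vtrunc :: "nat \<Rightarrow> nat \<Rightarrow> 'a::field op" where
  "vtrunc i n = (\<Sum>k<n. xprod i k * dd (i + 3 * k))"

lemma vtrunc_Suc: "vtrunc i (Suc n) = dd i + lx i * lx (i + 1) * vtrunc (i + 3) n"
  unfolding vtrunc_def sum.lessThan_Suc_shift xprod_Suc_left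
  by (simp add: sum_distrib_left mult.assoc add_ac)

lemma mat_vv:
  assumes "\<forall>s. s |\<in>| S \<longrightarrow> s < n"
  shows "mat (vv i) S U = mat (vtrunc i n) S U"
proof -
  \<comment> \<open>An index i + 3k below n forces k < n, so n summands suffice.\<close>
  have "{k. i + 3 * k |\<in>| S} \<subseteq> {..<n}" using assms by fastforce
  then have "(\<Sum>k | i + 3 * k |\<in>| S. mat (xprod i k * dd (i + 3 * k)) S U :: 'a)
      = (\<Sum>k<n. mat (xprod i k * dd (i + 3 * k)) S U)"
    by (intro sum.mono_neutral_left) (auto simp: mat_times_dd)
  then show ?thesis
    by (simp add: vtrunc_def mat_sum vv.rep_eq pivot_def times_op.rep_eq xprod.rep_eq dd.rep_eq)
qed

lemma fset_bounded: "\<exists>n::nat. \<forall>s. s |\<in>| S \<longrightarrow> s < n"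
  using finite_nat_set_iff_bounded[of "fset S"] by auto

lemma mat_times_cong:
  assumes "\<And>T. mat b S T = mat b' S T"
  shows "mat (a * b) S U = mat (a * b') S U"
  using assms by (simp add: mat_times)

text \<open>Splitting off the summand k = 0 leaves v_{i+3} with the left factor x_i x_{i+1}. This
  self-similarity drives \<open>ac_rec\<close> and \<open>Dm_notin\<close>.\<close>

lemma vv_rec: "vv i = dd i + lx i * lx (i + 1) * vv (i + 3)"
proof (rule op_eqI)
  fix S U :: "nat fset"
  obtain n where n: "\<forall>s. s |\<in>| S \<longrightarrow> s < n" using fset_bounded by metis
  \<comment> \<open>One summand more than the bound requires, because the recursion leaves the
    truncation of v_{i+3} at \<open>n\<close>.\<close>
  then have "mat (vv i) S U = mat (vtrunc i (Suc n)) S U"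
    by (intro mat_vv) (simp add: less_Suc_eq)
  also have "\<dots> = mat (dd i + lx i * lx (i + 1) * vv (i + 3)) S U"
    unfolding vtrunc_Suc mat_simps by (simp add: mat_times_cong[OF mat_vv[OF n]])
  finally show "mat (vv i) S U = mat (dd i + lx i * lx (i + 1) * vv (i + 3)) S U" .
qed

lemma xprod_comm:
  assumes "\<And>k. i \<le> k \<Longrightarrow> a * lx k = - (lx k * a)"
  shows "xprod i k * a = a * xprod i k"
proof (induction k)
  case (Suc k)
  have "lx (i + 3 * k) * lx (i + 3 * k + 1) * a = a * (lx (i + 3 * k) * lx (i + 3 * k + 1))"
    using assms[of "i + 3 * k"] assms[of "i + 3 * k + 1"]
    by (metis (no_types, lifting) le_add1 minus_mult_commute minus_minus mult.assoc mult_minus_left add.assoc)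
  then show ?case using Suc by (simp add: mult.assoc) (simp flip: mult.assoc)
qed simp

text \<open>Each summand is an even product of variables times one derivation, so moving
  \<open>a\<close> past it costs exactly one sign.\<close>

lemma vtrunc_anticomm:
  assumes "\<And>k. i \<le> k \<Longrightarrow> a * lx k = - (lx k * a)" "\<And>k. i \<le> k \<Longrightarrow> dd k * a = - (a * dd k)"
  shows "vtrunc i n * a = - (a * vtrunc i n)"
proof -
  have "xprod i k * dd (i + 3 * k) * a = - (a * (xprod i k * dd (i + 3 * k)))" for k
    using xprod_comm[OF assms(1), of i k] assms(2)[of "i + 3 * k"]
    by (simp add: mult.assoc) (simp flip: mult.assoc)
  then show ?thesis
    by (simp add: vtrunc_def sum_distrib_left sum_distrib_right sum_negf)
qed

text \<open>Only variables and derivations of index at least i occur in v_i, and all of them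
  anticommute with x_j.\<close>

lemma vv_lx: 
  assumes "j < i" shows "vv i * lx j = - (lx j * vv i)"
proof (rule op_eqI)
  fix S U :: "nat fset"
  \<comment> \<open>Multiplication by x_j enlarges \<open>S\<close>, so the truncation has to cover
    \<open>finsert j S\<close>.\<close>
  obtain n where n: "\<forall>s. s |\<in>| finsert j S \<longrightarrow> s < n" using fset_bounded by metis
  have "mat (vv i * lx j) S U = mat (vtrunc i n * lx j) S U"
    by (simp add: mat_times_lx mat_vv[OF n])
  also have "\<dots> = mat (- (lx j * vtrunc i n)) S U"
    by (subst vtrunc_anticomm) (use assms in \<open>auto simp: dd_lx intro: lx_swap\<close>)
  also have "\<dots> = mat (- (lx j * vv i)) S U"
    using n by (simp add: mat_times_cong[OF mat_vv[of S n]])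
  finally show "mat (vv i * lx j) S U = mat (- (lx j * vv i)) S U" .
qed

lemma vv_dd: 
  assumes "j < i" shows "vv i * dd j = - (dd j * vv i)"
proof (rule op_eqI)
  fix S U :: "nat fset"
  obtain n where n: "\<forall>s. s |\<in>| S \<longrightarrow> s < n" using fset_bounded by metis
  have "mat (vv i * dd j) S U = mat (vtrunc i n * dd j) S U"
    using n by (simp add: mat_times_dd mat_vv[of _ n])
  also have "\<dots> = mat (- (dd j * vtrunc i n)) S U"
    by (subst vtrunc_anticomm) (use assms in \<open>auto simp: dd_lx intro: dd_swap\<close>)
  also have "\<dots> = mat (- (dd j * vv i)) S U"
    using n by (simp add: mat_times_cong[OF mat_vv[of S n]])
  finally show "mat (vv i * dd j) S U = mat (- (dd j * vv i)) S U" .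
qed

text \<open>\<open>homog True\<close> means odd, \<open>homog False\<close> means even.\<close>

definition homog :: "bool \<Rightarrow> 'a::field op \<Rightarrow> bool" where
  "homog p a \<longleftrightarrow> (\<forall>S T. mat a S T \<noteq> 0 \<longrightarrow> odd (fcard S + fcard T) = p)"

lemma homog_mult:
  assumes "homog p a" "homog q b" shows "homog (p \<noteq> q) (a * b)"
  unfolding homog_def
proof (intro allI impI)
  fix S U assume "mat (a * b) S U \<noteq> 0"
  then obtain T where "mat b S T * mat a T U \<noteq> 0"
    unfolding mat_times by (metis (mono_tags, lifting) sum.neutral)
  then have "odd (fcard T + fcard U) = p" "odd (fcard S + fcard T) = q"
    using assms by (auto simp: homog_def)
  then show "odd (fcard S + fcard U) = (p \<noteq> q)" by auto
qed

lemma homog_zero: "homog p 0" by (simp add: homog_def)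
lemma homog_one: "homog False 1" by (simp add: homog_def)
lemma homog_add: "homog p a \<Longrightarrow> homog p b \<Longrightarrow> homog p (a + b)"
  unfolding homog_def mat_simps by (metis add.right_neutral add_0)

lemma homog_sum: "(\<And>i. i \<in> A \<Longrightarrow> homog p (f i)) \<Longrightarrow> homog p (sum f A)"
  by (induction A rule: infinite_finite_induct) (auto intro: homog_zero homog_add)

lemma homog_lx: "homog True (lx i)"
  by (auto simp: homog_def mat_lx fcard_finsert_if split: if_splits)

lemma homog_dd: "homog True (dd i)"
proof -
  have "odd (fcard S + fcard (S |-| {|i|}))" if "i |\<in>| S" for S
    using that fcard_fminus_fsingleton[of i S] fcard_fempty 
    by (metis add.commute even_Suc even_add fcard_Suc_fminus1)
  then show ?thesis by (auto simp: homog_def mat_dd split: if_splits)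
qed

lemma homog_xprod: "homog False (xprod i k)"
proof (induction k)
  case (Suc k)
  show ?case
    using homog_mult[OF Suc homog_mult[OF homog_lx[of "i + 3 * k"] homog_lx[of "i + 3 * k + 1"]]] by simp
qed (simp add: homog_one)

lemma homog_vv: "homog True (vv i)"
proof -
  have "homog True (vtrunc i n)" for n
    unfolding vtrunc_def using homog_mult[OF homog_xprod homog_dd] by (auto intro: homog_sum)
  then show ?thesis
    unfolding homog_def by (metis fset_bounded mat_vv)
qed

lemma ev_homog: "homog p a \<Longrightarrow> ev a = (if p then 0 else a)"
  by (rule op_eqI) (auto simp: homog_def ev.rep_eq even_part_def)

lemma od_homog: "homog p a \<Longrightarrow> od a = (if p then a else 0)"
  by (rule op_eqI) (auto simp: homog_def od.rep_eq odd_part_def)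

section \<open>The supercommutator on operators and normal ordering\<close>

definition sb :: "'a::field op \<Rightarrow> 'a op \<Rightarrow> 'a op" where
  "sb a b = (ev a * b - b * ev a) + (od a * ev b - ev b * od a) + (od a * od b + od b * od a)"

lemma mat_sb: "mat (sb a b) = sbr (mat a) (mat b)"
  by (simp add: sb_def sbr_def plus_op.rep_eq minus_op.rep_eq times_op.rep_eq ev.rep_eq od.rep_eq)

lemma ev_add: "ev (a + b) = ev a + ev b" and od_add: "od (a + b) = od a + od b"
  and ev_scl: "ev (scl c a) = scl c (ev a)" and od_scl: "od (scl c a) = scl c (od a)"
  by (auto intro!: op_eqI simp: ev.rep_eq od.rep_eq even_part_def odd_part_def plus_op.rep_eq
      scl.rep_eq escale_def)

lemma sb_add_left: "sb (a + b) c = sb a c + sb b c"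
  and sb_add_right: "sb c (a + b) = sb c a + sb c b"
  by (simp_all add: sb_def ev_add od_add algebra_simps)

lemma sb_scl_left: "sb (scl c a) b = scl c (sb a b)"
  and sb_scl_right: "sb a (scl c b) = scl c (sb a b)"
  by (simp_all add: sb_def ev_scl od_scl scl_add scl_diff)

lemma sb_homog:
  assumes "homog p a" "homog q b"
  shows "sb a b = (if p \<and> q then a * b + b * a else a * b - b * a)"
  using assms by (auto simp: sb_def ev_homog od_homog)

text \<open>The condition orients \<open>lx_swap\<close>: rewriting sorts variables by increasing
  index and cannot loop.\<close>

lemma lx_lx: "j < i \<Longrightarrow> lx i * lx j = - (lx j * lx i)" by (rule lx_swap)

text \<open>Adapts a relation for two factors to the head of a right-nested product.\<close>

lemma left_assoc_rule:
  fixes a :: "'a::ring"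
  assumes "a * b = c" shows "a * (b * e) = c * e"
  using assms by (simp flip: mult.assoc)

text \<open>Normal ordering: variables move left in increasing order, past derivations and past
  pivots of larger index; derivations move left past pivots of larger index.\<close>

lemmas car = lx_lx lx_lx[THEN left_assoc_rule] lx_sq lx_sq[THEN left_assoc_rule]
  dd_lx dd_lx[THEN left_assoc_rule] dd_lx_same dd_lx_same[THEN left_assoc_rule]
  vv_lx vv_lx[THEN left_assoc_rule] vv_dd vv_dd[THEN left_assoc_rule] dd_sq dd_sq[THEN left_assoc_rule]

section \<open>Squares and anticommutators of pivots\<close>

lemma vv_lx_same: "vv i * lx i = 1 - lx i * vv i"
  by (subst (1 2) vv_rec) (simp add: algebra_simps car)

lemma vv_sq: "vv i * vv i = lx (i + 1) * vv (i + 3)"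
  by (subst (1 2) vv_rec) (simp add: algebra_simps car)

definition ac :: "nat \<Rightarrow> nat \<Rightarrow> 'a::field op" where
  "ac n m = vv n * vv m + vv m * vv n"

text \<open>By \<open>n + 2 \<le> m\<close>, v_m anticommutes with x_n, x_{n+1} and the n-th
  derivation. The derivation terms cancel and the even factor x_n x_{n+1} comes out.\<close>

lemma ac_rec: "n + 2 \<le> m \<Longrightarrow> ac n m = lx n * (lx (n + 1) * ac (n + 3) m)"
  unfolding ac_def by (subst (1 2) vv_rec[of n]) (simp add: algebra_simps car)

lemma lx_ac: "n + 2 \<le> m \<Longrightarrow> lx n * ac n m = 0"
  by (simp add: ac_rec car)

lemma ac_commute: "ac n m = ac m n"
  by (simp add: ac_def add.commute)

lemma ac_Suc: "ac n (Suc n) = - (lx n * vv (n + 3))"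
proof -
  \<comment> \<open>Unlike in \<open>ac_rec\<close>, moving v_{n+1} past x_{n+1} leaves an extra
    term, - x_n v_{n+3}. The other term vanishes by \<open>lx_ac\<close>.\<close>
  have "ac n (Suc n) = lx n * (lx (Suc n) * ac (Suc n) (n + 3)) - lx n * vv (n + 3)"
    unfolding ac_def
    by (subst (1 2) vv_rec[of n])
      (simp add: algebra_simps car vv_lx_same vv_lx_same[THEN left_assoc_rule])
  then show ?thesis by (simp add: lx_ac)
qed

text \<open>\<open>ac_rec\<close> leads to the indices n + 3 and n + 2, which are adjacent, so
  \<open>ac_Suc\<close> applies after commuting them.\<close>

lemma ac_Suc_Suc: "(ac n (n + 2) :: 'a::field op) = - (lx n * (lx (n + 1) * (lx (n + 2) * vv (n + 5))))"
proof -
  have "(ac (n + 3) (n + 2) :: 'a op) = - (lx (n + 2) * vv (n + 5))"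
    unfolding ac_commute[of "n + 3"] using ac_Suc[of "n + 2"] by (simp add: numeral_eq_Suc)
  then show ?thesis by (simp add: ac_rec)
qed

lemma scl_2: "scl 2 a = a + a"
  using scl_add_left[of 1 1 a] by simp

lemma ac_same: "ac n n = scl 2 (lx (n + 1) * vv (n + 3))"
  by (simp add: ac_def vv_sq scl_2)

section \<open>Monomials in the generators\<close>

text \<open>All membership questions below are insensitive to signs, so monomials are compared only up to sign.\<close>

definition eq_sign :: "'a::field op \<Rightarrow> 'a op \<Rightarrow> bool" (infix "\<simeq>" 50) where
  "a \<simeq> b \<longleftrightarrow> a = b \<or> a = - b"

lemma eq_sign_refl [simp]: "a \<simeq> a" by (simp add: eq_sign_def)
lemma eq_sign_sym: "a \<simeq> b \<Longrightarrow> b \<simeq> a" by (auto simp: eq_sign_def)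
lemma eq_sign_trans [trans]: "a \<simeq> b \<Longrightarrow> b \<simeq> c \<Longrightarrow> a \<simeq> c" by (auto simp: eq_sign_def)
lemma eq_sign_mult: "a \<simeq> b \<Longrightarrow> c \<simeq> e \<Longrightarrow> a * c \<simeq> b * e" by (auto simp: eq_sign_def)
lemma eq_sign_uminus: "- a \<simeq> b \<longleftrightarrow> a \<simeq> b" by (auto simp: eq_sign_def)
lemma eq_sign_power: "scl ((- 1) ^ n) a \<simeq> a" by (cases "even n") (auto simp: eq_sign_def)

definition xm :: "nat set \<Rightarrow> 'a::field op" where
  "xm S = prod_list (map lx (sorted_list_of_set S))"

lemma xm_empty [simp]: "xm {} = 1" by (simp add: xm_def)

lemma xm_insert_max:
  assumes "finite S" "\<And>s. s \<in> S \<Longrightarrow> s < k"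
  shows "xm (insert k S) = xm S * lx k"
proof -
  have "k \<notin> S" using assms(2) by blast
  then have "sorted_list_of_set (insert k S) = sorted_list_of_set S @ [k]"
    using assms by (subst sorted_list_of_set_insert) (auto intro!: sorted_insort_is_snoc less_imp_le)
  then show ?thesis by (simp add: xm_def)
qed

lemma xm_singleton [simp]: "xm {k} = lx k"
  using xm_insert_max[of "{}" k] by simp

lemma lx_prod_list_mem: "j \<in> set L \<Longrightarrow> lx j * prod_list (map lx L) = 0"
proof (induction L)
  case (Cons l L)
  then show ?case
    using lx_swap[of j l] by (cases "j = l") (auto simp: left_assoc_rule[OF lx_sq] left_assoc_rule[OF lx_swap[of j l]] mult.assoc)
qed simp

lemma lx_prod_list_insort: "(lx j :: 'a::field op) * prod_list (map lx L) \<simeq> prod_list (map lx (insort j L))"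
proof (induction L)
  case (Cons l L)
  have "(lx j :: 'a op) * (lx l * prod_list (map lx L)) = - (lx l * (lx j * prod_list (map lx L)))"
    by (subst left_assoc_rule[OF lx_swap[of j l]]) (simp add: mult.assoc)
  also have "\<dots> \<simeq> lx l * prod_list (map lx (insort j L))"
    using eq_sign_mult[OF eq_sign_refl Cons, of "lx l"] by (simp add: eq_sign_uminus)
  finally show ?case by simp
qed simp

lemma lx_xm_mem: "finite S \<Longrightarrow> j \<in> S \<Longrightarrow> lx j * xm S = 0"
  unfolding xm_def by (rule lx_prod_list_mem) simp

lemma xm_insert: "finite S \<Longrightarrow> j \<notin> S \<Longrightarrow> xm (insert j S) \<simeq> lx j * xm S"
  unfolding xm_def by (auto intro: eq_sign_sym lx_prod_list_insort)

lemma xm_mult: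
  assumes "finite S" "finite T" "S \<inter> T = {}"
  shows "(xm S :: 'a::field op) * xm T \<simeq> xm (S \<union> T)"
  using assms
proof (induction S rule: finite_induct)
  case (insert j S)
  have "(xm (insert j S) :: 'a op) * xm T \<simeq> lx j * (xm S * xm T)"
    unfolding mult.assoc[symmetric] using insert by (intro eq_sign_mult xm_insert) auto
  also have "\<dots> \<simeq> lx j * xm (S \<union> T)" using insert by (intro eq_sign_mult) auto
  also have "\<dots> \<simeq> xm (insert j (S \<union> T))"
    using insert by (intro eq_sign_sym[OF xm_insert]) auto
  finally show ?case by simp
qed simp

lemma xm_anticomm:
  assumes "finite S" "\<And>s. s \<in> S \<Longrightarrow> a * lx s = - (lx s * a)"
  shows "a * xm S = scl ((- 1) ^ card S) (xm S * a)"
proof -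
  have "a * prod_list (map lx L) = scl ((- 1) ^ length L) (prod_list (map lx L) * a)"
    if "\<And>s. s \<in> set L \<Longrightarrow> a * lx s = - (lx s * a)" for L
    using that
  proof (induction L)
    case (Cons l L)
    have "a * (lx l * prod_list (map lx L)) = - (lx l * (a * prod_list (map lx L)))"
      using Cons.prems[of l] by (subst left_assoc_rule) (auto simp: mult.assoc)
    then show ?case using Cons by (simp add: mult.assoc)
  qed simp
  from this[of "sorted_list_of_set S"] show ?thesis using assms by (simp add: xm_def)
qed

lemma lx_xm: "finite S \<Longrightarrow> lx j * xm S = scl ((- 1) ^ card S) (xm S * lx j)"
  by (intro xm_anticomm lx_swap)

lemma dd_xm: "finite S \<Longrightarrow> j \<notin> S \<Longrightarrow> dd j * xm S = scl ((- 1) ^ card S) (xm S * dd j)"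
  by (intro xm_anticomm dd_lx) auto

lemma vv_xm: "finite S \<Longrightarrow> S \<subseteq> {..<m} \<Longrightarrow> vv m * xm S = scl ((- 1) ^ card S) (xm S * vv m)"
  by (intro xm_anticomm vv_lx) auto

lemma xm_commute:
  assumes "finite S" "finite T"
  shows "(xm T :: 'a::field op) * xm S = scl ((- 1) ^ (card S * card T)) (xm S * xm T)"
proof -
  note * = lx_xm[OF assms(1), where ?'a='a]
  have "(prod_list (map lx L) :: 'a op) * xm S = scl ((- 1) ^ (card S * length L)) (xm S * prod_list (map lx L))"
    for L
  proof (induction L)
    case (Cons l L)
    have "(lx l :: 'a op) * (xm S * prod_list (map lx L)) = scl ((- 1) ^ card S) (xm S * (lx l * prod_list (map lx L)))"
      by (subst left_assoc_rule[OF *]) (simp add: mult.assoc)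
    then show ?case using Cons by (simp add: mult.assoc power_add mult.commute)
  qed simp
  from this[of "sorted_list_of_set T"] show ?thesis using assms by (simp add: xm_def[of T])
qed

lemma xm_mult_zero:
  assumes "finite S" "finite T" "j \<in> S" "j \<in> T"
  shows "(xm S :: 'a::field op) * xm T = 0"
proof -
  have "(xm S :: 'a op) \<simeq> lx j * xm (S - {j})"
    using xm_insert[of "S - {j}" j] assms by (simp add: insert_absorb)
  also have "\<dots> \<simeq> xm (S - {j}) * lx j"
    using assms by (subst lx_xm) (auto intro: eq_sign_power)
  finally have "(xm S :: 'a op) * xm T \<simeq> xm (S - {j}) * lx j * xm T"
    by (intro eq_sign_mult) auto
  then show ?thesis using assms by (auto simp: mult.assoc eq_sign_def lx_xm_mem)
qed

lemma homog_xm: "homog (odd (card S)) (xm S)"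
proof -
  have "homog (odd (length L)) (prod_list (map lx L))" for L
  proof (induction L)
    case (Cons l L)
    show ?case using homog_mult[OF homog_lx[of l] Cons] by simp
  qed (simp add: homog_one)
  from this[of "sorted_list_of_set S"] show ?thesis by (simp add: xm_def)
qed

lemma homog_xm_vv: "homog (even (card S)) (xm S * vv m)"
  using homog_mult[OF homog_xm homog_vv, of S m] by simp

text \<open>The image of the monomial \<open>xm T\<close> under the superderivation \<open>vv n\<close>, as a multiplication operator.\<close>

definition Dm :: "nat \<Rightarrow> nat set \<Rightarrow> 'a::field op" where
  "Dm n T = vv n * xm T - scl ((- 1) ^ card T) (xm T * vv n)"

lemma Dm_zero: "finite T \<Longrightarrow> T \<subseteq> {..<n} \<Longrightarrow> Dm n T = 0"
  by (simp add: Dm_def vv_xm)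

text \<open>The derivation part of v_n supercommutes with x_T, so only x_n x_{n+1} v_{n+3}
  acts.\<close>

lemma Dm_notin:
  assumes "finite T" "n \<notin> T"
  shows "(Dm n T :: 'a::field op) = lx n * (lx (n + 1) * Dm (n + 3) T)"
proof -
  have "(xm T :: 'a op) * (lx n * lx (n + 1)) = lx n * (lx (n + 1) * xm T)"
    by (simp add: lx_xm[OF assms(1)] left_assoc_rule[OF lx_xm[OF assms(1)]] mult.assoc)
  then have "(xm T :: 'a op) * (lx n * (lx (n + 1) * vv (n + 3))) = lx n * (lx (n + 1) * (xm T * vv (n + 3)))"
    using left_assoc_rule[of "xm T :: 'a op" "lx n * lx (n + 1)" "lx n * (lx (n + 1) * xm T)" "vv (n + 3)"]
    by (simp add: mult.assoc)
  then show ?thesis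
    unfolding Dm_def
    by (subst (1 2) vv_rec[of n])
       (simp add: algebra_simps scl_add scl_diff dd_xm[OF assms])
qed

text \<open>Up to sign x_T = x_n M, and the Leibniz rule gives M - x_n v_n(M). By
  \<open>Dm_notin\<close>, v_n(M) is itself a left multiple of x_n, so the second term is 0.\<close>

lemma Dm_mem:
  assumes "finite T" "n \<in> T"
  shows "(Dm n T :: 'a::field op) \<simeq> xm (T - {n})"
proof -
  let ?M = "xm (T - {n}) :: 'a op" and ?q = "card (T - {n})"
  have c: "card T = Suc ?q" using assms card_Suc_Diff1 by metis
  have "vv n * (lx n * ?M) - scl ((- 1) ^ card T) (lx n * ?M * vv n) = ?M - lx n * Dm n (T - {n})"
    by (simp add: Dm_def c left_assoc_rule[OF vv_lx_same] algebra_simps)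
  also have "\<dots> = ?M"
    by (subst Dm_notin) (use assms in \<open>auto simp: left_assoc_rule[OF lx_sq]\<close>)
  finally have *: "vv n * (lx n * ?M) - scl ((- 1) ^ card T) (lx n * ?M * vv n) = ?M" .
  have "xm T \<simeq> lx n * ?M"
    using xm_insert[of "T - {n}" n] assms by (simp add: insert_absorb)
  then show ?thesis
    unfolding eq_sign_def
  proof
    assume "xm T = lx n * ?M"
    then show "Dm n T = ?M \<or> Dm n T = - ?M" using * by (simp add: Dm_def)
  next
    assume "xm T = - (lx n * ?M)"
    then have "Dm n T = - (vv n * (lx n * ?M) - scl ((- 1) ^ card T) (lx n * ?M * vv n))"
      by (simp add: Dm_def)
    then show "Dm n T = ?M \<or> Dm n T = - ?M" using * by simp
  qed
qed

text \<open>The sign is exact here because \<open>leading_vv\<close> sums such images and has to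
  track their coefficients.\<close>

lemma Dm_max:
  assumes "finite T" "T \<subseteq> {..<n}"
  shows "Dm n (insert n T) = scl ((- 1) ^ card T) (xm T)"
proof -
  have m: "xm (insert n T) = xm T * lx n" using assms by (intro xm_insert_max) auto
  have "n \<notin> T" using assms by auto
  then show ?thesis
    unfolding Dm_def m using assms
    by (simp add: left_assoc_rule[OF vv_xm[OF assms]] mult.assoc vv_lx_same algebra_simps scl_diff)
qed

text \<open>The first k in T among n, n + 3, n + 6, ... is differentiated away. The pairs collected
  before it, the last being k - 3 and k - 2, form R; a collision of a pair with T gives 0.\<close>

lemma Dm_cases:
  assumes "finite T"
  shows "(Dm n T :: 'a::field op) = 0 \<or> (\<exists>k R. k \<in> T \<and> n \<le> k \<and> R \<subseteq> {n..<k - 1} \<and> R \<inter> T = {} \<and> (Dm n T :: 'a op) \<simeq> xm (T - {k} \<union> R))"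
proof -
  obtain b where b: "T \<subseteq> {..<b}" using assms finite_nat_set_iff_bounded[of T] by auto
  show ?thesis
  proof (induction "b - n" arbitrary: n rule: less_induct)
    case less
    consider "b \<le> n" | "n \<in> T" | "n < b" "n \<notin> T" by fastforce
    then show ?case
    proof cases
      case 1
      then have "T \<subseteq> {..<n}" using b by auto
      then show ?thesis using assms Dm_zero by blast
    next
      case 2
      then show ?thesis using Dm_mem[OF assms 2] by (intro disjI2 exI[of _ n] exI[of _ "{}"]) auto
    next
      case 3
      then have rec: "(Dm n T :: 'a op) = lx n * (lx (n + 1) * Dm (n + 3) T)" using assms Dm_notin by blast
      have "b - (n + 3) < b - n" using 3 by simp
      from less[OF this] consider "(Dm (n + 3) T :: 'a op) = 0"
        | k R where "k \<in> T" "n + 3 \<le> k" "R \<subseteq> {n + 3..<k - 1}" "R \<inter> T = {}" "(Dm (n + 3) T :: 'a op) \<simeq> xm (T - {k} \<union> R)"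
        by metis
      then show ?thesis
      proof cases
        case 1
        then show ?thesis by (simp add: rec)
      next
        case (2 k R)
        let ?U = "T - {k} \<union> R"
        have fin: "finite ?U" using assms 2 finite_subset by auto
        have *: "(Dm n T :: 'a op) \<simeq> lx n * (lx (n + 1) * xm ?U)"
          unfolding rec using 2 by (intro eq_sign_mult) auto
        show ?thesis
        proof (cases "n + 1 \<in> ?U")
          case True
          then have "lx (n + 1) * (xm ?U :: 'a op) = 0" by (rule lx_xm_mem[OF fin])
          then have "(Dm n T :: 'a op) = 0" using * by (auto simp: eq_sign_def)
          then show ?thesis by blast
        next
          case False
          have nU: "n \<notin> ?U" using 2 3 by auto
          note *
          also have "lx n * (lx (n + 1) * xm ?U) \<simeq> lx n * xm (insert (n + 1) ?U)"
            by (intro eq_sign_mult eq_sign_sym[OF xm_insert] fin False) auto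
          also have "\<dots> \<simeq> xm (insert n (insert (n + 1) ?U))"
            by (rule eq_sign_sym[OF xm_insert]) (use fin nU in auto)
          also have "insert n (insert (n + 1) ?U) = T - {k} \<union> (insert n (insert (n + 1) R))" by auto
          finally have e: "(Dm n T :: 'a op) \<simeq> xm (T - {k} \<union> (insert n (insert (n + 1) R)))" .
          have "n + 1 \<notin> T" using 2 False by auto
          then show ?thesis
            using 2 3 e by (intro disjI2 exI[of _ k] exI[of _ "insert n (insert (n + 1) R)"]) auto
        qed
      qed
    qed
  qed
qed

text \<open>This is the Leibniz rule. Since S lies below m, v_m passes x_S with a mere sign, and no
  term differentiating x_S appears.\<close>

lemma sb_xm:
  assumes "finite S" "finite T" "S \<subseteq> {..<m}"
  shows "(sb (xm S * vv n) (xm T * vv m) :: 'a::field op)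
    = xm S * Dm n T * vv m + scl ((- 1) ^ card T) (xm S * xm T * ac n m)"
proof -
  have 1: "(xm S * vv n :: 'a op) * (xm T * vv m)
      = xm S * Dm n T * vv m + scl ((- 1) ^ card T) (xm S * xm T * (vv n * vv m))"
    by (simp add: Dm_def algebra_simps)
  have 2: "(xm T * vv m :: 'a op) * (xm S * vv n)
      = scl ((- 1) ^ (card S + card S * card T)) (xm S * xm T * (vv m * vv n))"
    by (simp add: mult.assoc left_assoc_rule[OF vv_xm[OF assms(1,3)]]
        left_assoc_rule[OF xm_commute[OF assms(1,2)]] power_add)
  show ?thesis
    unfolding sb_homog[OF homog_xm_vv homog_xm_vv] 1 2 ac_def
    by (auto simp: algebra_simps scl_add minus_one_power_iff)
qed

lemma sb_swap:
  "sb (xm T * vv m) (xm S * vv n) \<simeq> sb (xm S * vv n) (xm T * vv m)"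
  unfolding sb_homog[OF homog_xm_vv homog_xm_vv] by (auto simp: eq_sign_def algebra_simps)

lemma eq_signE:
  assumes "a \<simeq> b" obtains e where "e = 1 \<or> e = - 1" "a = scl e b"
proof -
  from assms have "a = scl 1 b \<or> a = scl (- 1) b" by (simp add: eq_sign_def)
  then show ?thesis using that by blast
qed

section \<open>A spanning set of Q\<close>

text \<open>\<open>ac_rec\<close> raises n by 3 until m - n is 0, 1 or 2. The last clauses record
  what is needed later: a factor x_{m-3} or x_{m-2} for \<open>sb_lx_vv_tail\<close>, and for
  \<open>adm\<close> that a factor x_{r-2} stems from [v_m, v_m] with its coefficient 2.\<close>

lemma ac_structure:
  assumes "n \<le> m"
  shows "\<exists>c R r. (ac n m :: 'a::field op) = scl c (xm R * vv r) \<and>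
    (\<forall>i\<in>R. n \<le> i \<and> i + 2 \<le> r) \<and> m + 2 \<le> r \<and> r \<le> m + 3 \<and>
    (n + 2 \<le> m \<longrightarrow> (\<exists>i\<in>R. i + 3 = m \<or> i + 2 = m)) \<and>
    (\<forall>i\<in>R. i + 2 = r \<longrightarrow> r = m + 3 \<and> (\<forall>j\<in>R. j \<noteq> i \<longrightarrow> j + 2 \<le> m) \<and> ((2::'a) = 0 \<longrightarrow> c = 0))"
  using assms
proof (induction "m - n" arbitrary: n rule: less_induct)
  case less
  consider "m = n" | "m = n + 1" | "m = n + 2" | "n + 3 \<le> m" using less.prems by linarith
  then show ?case
  proof cases
    case 1
    then show ?thesis
      by (intro exI[of _ 2] exI[of _ "{n + 1}"] exI[of _ "n + 3"]) (simp add: ac_same)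
  next
    case 2
    then show ?thesis
      using ac_Suc[of n, where ?'a='a]
      by (intro exI[of _ "- 1"] exI[of _ "{n}"] exI[of _ "n + 3"]) simp
  next
    case 3
    have "xm (insert (n + 2) (insert (n + 1) {n})) = (lx n * lx (n + 1) * lx (n + 2) :: 'a op)"
      by (subst xm_insert_max; (subst xm_insert_max)?; auto)
    then show ?thesis
      using ac_Suc_Suc[of n, where ?'a='a] 3
      by (intro exI[of _ "- 1"] exI[of _ "insert (n + 2) (insert (n + 1) {n})"] exI[of _ "n + 5"])
         (simp add: mult.assoc)
  next
    case 4
    then have "m - (n + 3) < m - n" "n + 3 \<le> m" by auto
    from less.hyps[OF this] obtain c R r where
      ac: "(ac (n + 3) m :: 'a op) = scl c (xm R * vv r)" and
      R: "\<forall>i\<in>R. n + 3 \<le> i \<and> i + 2 \<le> r" and r: "m + 2 \<le> r" "r \<le> m + 3" and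
      R': "n + 3 + 2 \<le> m \<longrightarrow> (\<exists>i\<in>R. i + 3 = m \<or> i + 2 = m)" and
      top: "\<forall>i\<in>R. i + 2 = r \<longrightarrow> r = m + 3 \<and> (\<forall>j\<in>R. j \<noteq> i \<longrightarrow> j + 2 \<le> m) \<and> ((2::'a) = 0 \<longrightarrow> c = 0)"
      by (elim exE conjE) (rule that, assumption+)
    let ?R = "insert n (insert (n + 1) R)"
    have "R \<subseteq> {..r}" using R by auto
    then have "finite R" using finite_subset by blast
    then have "lx n * (lx (n + 1) * xm R) \<simeq> lx n * (xm (insert (n + 1) R) :: 'a op)"
      by (intro eq_sign_mult eq_sign_sym[OF xm_insert]) (use R in auto)
    also have "\<dots> \<simeq> xm ?R"
      using \<open>finite R\<close> R by (intro eq_sign_sym[OF xm_insert]) auto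
    finally obtain e where e: "lx n * (lx (n + 1) * xm R) = scl e (xm ?R :: 'a op)"
      by (rule eq_signE)
    have "ac n m = scl c (lx n * (lx (n + 1) * xm R) * vv r :: 'a op)"
      using 4 by (simp add: ac_rec ac mult.assoc)
    then have "(ac n m :: 'a op) = scl (c * e) (xm ?R * vv r)" unfolding e by simp
    \<comment> \<open>For m = n + 3 or m = n + 4 the induction hypothesis yields no such index; the
      new factor x_n or x_{n+1} does.\<close>
    moreover have "\<exists>i\<in>?R. i + 3 = m \<or> i + 2 = m"
    proof (cases "n + 5 \<le> m")
      case True
      then show ?thesis using R' by auto
    next
      case False
      then have "m = n + 3 \<or> m = n + 4" using 4 by linarith
      then show ?thesis by auto
    qed
    moreover have "\<forall>i\<in>?R. n \<le> i \<and> i + 2 \<le> r" using R r 4 by auto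
    moreover have "\<forall>i\<in>?R. i + 2 = r \<longrightarrow> r = m + 3 \<and> (\<forall>j\<in>?R. j \<noteq> i \<longrightarrow> j + 2 \<le> m) \<and> ((2::'a) = 0 \<longrightarrow> c * e = 0)"
      using top r 4 by auto
    ultimately show ?thesis using r by blast
  qed
qed

text \<open>The factor x_n makes x_T [v_n, v_m] vanish for n in T, as used in
  \<open>sb_vv_mem\<close>.\<close>

lemma ac_factor: "n < m \<Longrightarrow> \<exists>b. ac n m = lx n * b"
proof (cases "m = Suc n")
  case True
  then show ?thesis using ac_Suc[of n] by (metis mult_minus_right)
next
  case False
  assume "n < m"
  then show ?thesis using False ac_rec[of n m] by auto
qed

text \<open>
  The flag \<open>c\<close> says that the characteristic is two. There the only monomial of index \<open>m\<close> with factor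
  \<open>x\<^bsub>m-2\<^esub>\<close> comes from the square of \<open>v\<^bsub>m-3\<^esub>\<close>, because brackets producing such a
  factor carry the coefficient 2.
\<close>

definition adm :: "bool \<Rightarrow> nat \<Rightarrow> nat set \<Rightarrow> bool" where
  "adm c m S \<longleftrightarrow> finite S \<and> (\<forall>i\<in>S. i + 2 \<le> m) \<and>
     (\<forall>i\<in>S. i + 2 = m \<longrightarrow> (\<forall>j\<in>S. j \<noteq> i \<longrightarrow> j + 5 \<le> m \<and> \<not> c))"

text \<open>A decreasing filtration by pivot index: \<open>filt 0\<close> bounds Q from above, and
  the higher levels separate leading terms from the rest.\<close>

definition filt :: "nat \<Rightarrow> 'a::field op set" where
  "filt p = op.span {xm S * vv n | S n. p \<le> n \<and> adm ((2::'a) = 0) n S}"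

lemma filt_mono: "p \<le> q \<Longrightarrow> filt q \<subseteq> filt p"
  unfolding filt_def by (rule op.span_mono) (blast intro: order_trans)

lemma filt_gen: "adm ((2::'a::field) = 0) n S \<Longrightarrow> p \<le> n \<Longrightarrow> (xm S * vv n :: 'a op) \<in> filt p"
  unfolding filt_def by (rule op.span_base) auto

lemma filt_0: "0 \<in> filt p" and filt_add: "a \<in> filt p \<Longrightarrow> b \<in> filt p \<Longrightarrow> a + b \<in> filt p"
  and filt_scl: "a \<in> filt p \<Longrightarrow> scl c a \<in> filt p" and filt_neg: "a \<in> filt p \<Longrightarrow> - a \<in> filt p"
  unfolding filt_def
  by (auto intro: op.span_zero op.span_add op.span_scale op.span_neg)

lemma filt_eq_sign: "a \<simeq> b \<Longrightarrow> b \<in> filt p \<Longrightarrow> a \<in> filt p"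
  by (auto simp: eq_sign_def intro: filt_neg)

lemma filt_induct [consumes 1, case_names zero gen]:
  assumes "(a :: 'a::field op) \<in> filt p" "P 0"
    "\<And>c S n b. p \<le> n \<Longrightarrow> adm ((2::'a) = 0) n S \<Longrightarrow> b \<in> filt p \<Longrightarrow> P b \<Longrightarrow> P (scl c (xm S * vv n) + b)"
  shows "P a"
proof -
  have "a \<in> filt p \<and> P a"
    using assms(1) unfolding filt_def
  proof (induction rule: op.span_induct_alt)
    case base
    then show ?case using assms(2) filt_0[of p] by (simp add: filt_def)
  next
    case (step c x y)
    then show ?case
      using assms(3) filt_add[OF filt_scl[OF filt_gen]] by (auto simp: filt_def[symmetric])
  qed
  then show ?thesis ..
qed

lemma xm_mult_filt:
  assumes "finite S" "finite T" "S \<inter> T = {} \<Longrightarrow> adm ((2::'a::field) = 0) r (S \<union> T)" "p \<le> r"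
  shows "(xm S * xm T * vv r :: 'a op) \<in> filt p"
proof (cases "S \<inter> T = {}")
  case True
  have "(xm S * xm T * vv r :: 'a op) \<simeq> xm (S \<union> T) * vv r"
    by (intro eq_sign_mult xm_mult True assms) auto
  then show ?thesis by (rule filt_eq_sign) (intro filt_gen assms True)
next
  case False
  then have "(xm S * xm T :: 'a op) = 0" using assms xm_mult_zero by blast
  then show ?thesis by (simp add: filt_0)
qed

text \<open>S and R lie below k - 1, where k is the deleted index. A factor x_{m-2} is therefore an
  element of T other than k, and admissibility of T bounds everything else.\<close>

lemma Dm_filt:
  assumes "adm ((2::'a::field) = 0) n S" "adm ((2::'a) = 0) m T" "n \<le> m"
  shows "(xm S * Dm n T * vv m :: 'a op) \<in> filt m"
proof -
  have fin: "finite S" "finite T" using assms by (auto simp: adm_def)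
  from Dm_cases[OF fin(2), of n, where ?'a='a] consider "(Dm n T :: 'a op) = 0"
    | k R where "k \<in> T" "n \<le> k" "R \<subseteq> {n..<k - 1}" "R \<inter> T = {}" "(Dm n T :: 'a op) \<simeq> xm (T - {k} \<union> R)"
    by blast
  then show ?thesis
  proof cases
    case 1
    then show ?thesis by (simp add: filt_0)
  next
    case (2 k R)
    have "xm S * Dm n T * vv m \<simeq> xm S * (xm (T - {k} \<union> R) :: 'a op) * vv m"
      by (intro eq_sign_mult 2) auto
    moreover have "finite R" using 2 finite_subset by blast
    moreover have "adm ((2::'a) = 0) m (S \<union> (T - {k} \<union> R))"
      unfolding adm_def
    proof (intro conjI ballI impI)
      have k: "k + 2 \<le> m" using 2 assms by (auto simp: adm_def)
      have S: "i + 2 \<le> k" if "i \<in> S" for i using that assms 2 by (auto simp: adm_def)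
      have R: "i + 2 \<le> k" if "i \<in> R" for i using that 2(3) by fastforce
      show "finite (S \<union> (T - {k} \<union> R))" using fin \<open>finite R\<close> by auto
      show "i + 2 \<le> m" if "i \<in> S \<union> (T - {k} \<union> R)" for i
        using that S[of i] R[of i] k assms by (auto simp: adm_def)
      fix i j assume i: "i \<in> S \<union> (T - {k} \<union> R)" "i + 2 = m" and j: "j \<in> S \<union> (T - {k} \<union> R)" "j \<noteq> i"
      then have iT: "i \<in> T" "k \<noteq> i" using S[of i] R[of i] k by auto
      then have k': "k + 5 \<le> m" "\<not> (2::'a) = 0" using assms 2 i by (auto simp: adm_def)
      then show "\<not> (2::'a) = 0" by simp
      show "j + 5 \<le> m"
        using j S[of j] R[of j] k' iT i assms by (auto simp: adm_def)
    qed
    ultimately show ?thesis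
      using fin by (elim filt_eq_sign) (intro xm_mult_filt, auto)
  qed
qed

text \<open>S and T reach at most m - 2, so a factor x_{r-2} can only come from R. Then r = m + 3 by
  \<open>ac_structure\<close>, and m - 2 = r - 5 is the bound demanded by
  \<open>adm\<close>.\<close>

lemma ac_filt:
  assumes "adm ((2::'a::field) = 0) n S" "adm ((2::'a) = 0) m T" "n \<le> m"
  shows "(xm S * xm T * ac n m :: 'a op) \<in> filt (m + 1)"
proof -
  have fin: "finite S" "finite T" using assms by (auto simp: adm_def)
  obtain c R r where ac: "(ac n m :: 'a op) = scl c (xm R * vv r)" and
      R: "\<forall>i\<in>R. n \<le> i \<and> i + 2 \<le> r" and r: "m + 2 \<le> r" "r \<le> m + 3" and
      top: "\<forall>i\<in>R. i + 2 = r \<longrightarrow> r = m + 3 \<and> (\<forall>j\<in>R. j \<noteq> i \<longrightarrow> j + 2 \<le> m) \<and> ((2::'a) = 0 \<longrightarrow> c = 0)"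
    using ac_structure[OF assms(3), where ?'a='a] by (elim exE conjE) (rule that, assumption+)
  have "R \<subseteq> {..r}" using R by auto
  then have finR: "finite R" using finite_subset by blast
  have S: "i + 2 \<le> m" if "i \<in> S \<union> T" for i using that assms by (auto simp: adm_def)
  show ?thesis
  proof (cases "c = 0 \<or> S \<inter> T \<noteq> {}")
    case True
    then have "c = 0 \<or> (xm S * xm T :: 'a op) = 0" using fin xm_mult_zero by blast
    then show ?thesis by (auto simp: ac filt_0)
  next
    case False
    have "(xm S * xm T) * (xm R * vv r) \<simeq> xm (S \<union> T) * (xm R * vv r :: 'a op)"
      using False fin by (intro eq_sign_mult xm_mult) auto
    moreover have "(xm (S \<union> T) * xm R * vv r :: 'a op) \<in> filt (m + 1)"
    proof (rule xm_mult_filt)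
      show "adm ((2::'a) = 0) r ((S \<union> T) \<union> R)"
        unfolding adm_def
      proof (intro conjI ballI impI)
        show "finite (S \<union> T \<union> R)" using fin finR by auto
        show "i + 2 \<le> r" if "i \<in> S \<union> T \<union> R" for i
          using that S[of i] R r by auto
        fix i j assume i: "i \<in> S \<union> T \<union> R" "i + 2 = r" and j: "j \<in> S \<union> T \<union> R" "j \<noteq> i"
        then have iR: "i \<in> R" using S[of i] r by auto
        with top i have t: "r = m + 3" "\<forall>j\<in>R. j \<noteq> i \<longrightarrow> j + 2 \<le> m" "(2::'a) = 0 \<longrightarrow> c = 0" by auto
        show "j + 5 \<le> r" using t j S[of j] by auto
        show "\<not> (2::'a) = 0" using t False by auto
      qed
    qed (use fin finR r in auto)
    ultimately show ?thesis
      using filt_eq_sign[of "xm S * xm T * (xm R * vv r) :: 'a op"] by (simp add: ac filt_scl mult.assoc)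
  qed
qed

lemma sb_xm_filt:
  assumes "adm ((2::'a::field) = 0) n S" "adm ((2::'a) = 0) m T" "n \<le> m"
  shows "(sb (xm S * vv n) (xm T * vv m) :: 'a op) \<in> filt m"
proof -
  have "S \<subseteq> {..<m}" "finite S" "finite T" using assms by (auto simp: adm_def)
  then show ?thesis
    using Dm_filt[OF assms] ac_filt[OF assms] filt_mono[of m "m + 1"]
    by (auto simp: sb_xm intro!: filt_add filt_scl)
qed

lemma sb_0 [simp]: "sb 0 a = 0" "sb a 0 = 0"
  using sb_scl_left[of 0 0 a] sb_scl_right[of a 0 0] by simp_all

lemma sb_filt:
  assumes "(a :: 'a::field op) \<in> filt p" "b \<in> filt p"
  shows "sb a b \<in> filt p"
  using assms(1)
proof (induction rule: filt_induct)
  case (gen c S n a)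
  have "sb (xm S * vv n) b \<in> filt p"
    using assms(2)
  proof (induction rule: filt_induct)
    case (gen c' T m b)
    have "sb (xm S * vv n) (xm T * vv m :: 'a op) \<in> filt p"
    proof (cases "n \<le> m")
      case True
      then show ?thesis
        using sb_xm_filt[OF \<open>adm ((2::'a) = 0) n S\<close> gen(2)] filt_mono[OF gen(1)] by blast
    next
      case False
      then have "sb (xm T * vv m) (xm S * vv n :: 'a op) \<in> filt p"
        using sb_xm_filt[OF gen(2) \<open>adm ((2::'a) = 0) n S\<close>] filt_mono[OF \<open>p \<le> n\<close>] by auto
      then show ?thesis by (rule filt_eq_sign[OF sb_swap])
    qed
    then show ?case using gen by (simp add: sb_add_right sb_scl_right filt_add filt_scl)
  qed (simp add: filt_0)
  then show ?case using gen by (simp add: sb_add_left sb_scl_left filt_add filt_scl)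
qed (simp add: filt_0)

lemma adm_empty: "adm c n {}" by (simp add: adm_def)

lemma vv_filt: "p \<le> n \<Longrightarrow> vv n \<in> filt p"
  using filt_gen[OF adm_empty] by fastforce

lemma sb_vv_filt:
  assumes "k \<le> p" "(a :: 'a::field op) \<in> filt p" shows "sb (vv k) a \<in> filt p"
  using assms(2)
proof (induction rule: filt_induct)
  case (gen c S n b)
  have "sb (vv k) (xm S * vv n :: 'a op) \<in> filt p"
    using sb_xm_filt[OF adm_empty gen(2), of k] filt_mono[OF gen(1)] gen(1) assms by (auto simp: subset_iff)
  then show ?case using gen by (simp add: sb_add_right sb_scl_right filt_add filt_scl)
qed (simp add: filt_0)

section \<open>Containment of Q in the span of admissible monomials\<close>

definition opQ :: "'a::field op set" where "opQ = {a. mat a \<in> Qalg}"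

lemma od_0 [simp]: "od 0 = 0"
  by (simp add: od_homog[of True] homog_zero)

lemma od_filt: "(a :: 'a::field op) \<in> filt p \<Longrightarrow> od a \<in> filt p"
proof (induction rule: filt_induct)
  case (gen c S n b)
  have "od (xm S * vv n :: 'a op) \<in> filt p"
    using gen by (auto simp: od_homog[OF homog_xm_vv] filt_0 filt_gen)
  then show ?case using gen by (simp add: od_add od_scl filt_add filt_scl)
qed (simp add: filt_0)

lemma xm_vv_sq:
  assumes "adm ((2::'a::field) = 0) n S"
  shows "(xm S * vv n * (xm S * vv n) :: 'a op) \<in> filt 0"
proof (cases "S = {}")
  case True
  \<comment> \<open>This is the exceptional factor x_{r-2} with r = n + 3; standing alone it is
    admissible in characteristic two as well.\<close>
  have "adm ((2::'a) = 0) (n + 3) {n + 1}" by (auto simp: adm_def)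
  from filt_gen[OF this, of 0] True show ?thesis by (simp add: vv_sq)
next
  case False
  have S: "finite S" "S \<subseteq> {..<n}" using assms by (auto simp: adm_def)
  have "xm S * (xm S * (vv n * vv n)) = (0 :: 'a op)"
    using False S left_assoc_rule[OF xm_mult_zero[of S S]] by fastforce
  then have "xm S * vv n * (xm S * vv n) = (0 :: 'a op)"
    by (simp add: mult.assoc left_assoc_rule[OF vv_xm[OF S]])
  then show ?thesis by (simp add: filt_0)
qed

text \<open>Squaring is not linear, but the cross term ab + ba of odd elements is a superbracket and
  \<open>sb_filt\<close> covers it. Taking odd parts avoids a homogeneity hypothesis in the
  induction.\<close>

lemma od_sq_filt: 
  assumes "(a :: 'a::field op) \<in> filt 0" shows "od a * od a \<in> filt 0"
  using assms
proof (induction rule: filt_induct)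
  case (gen c S n b)
  let ?x = "od (xm S * vv n :: 'a op)"
  have x: "?x = (if even (card S) then xm S * vv n else 0)"
    by (rule od_homog) (rule homog_xm_vv)
  have "?x * ?x \<in> filt 0" using x xm_vv_sq gen by (auto simp: filt_0)
  moreover have "?x * od b + od b * ?x \<in> filt 0"
  proof -
    have "homog True (od a)" for a :: "'a op"
      by (auto simp: homog_def od.rep_eq odd_part_def split: if_splits)
    then have "sb ?x (od b) = ?x * od b + od b * ?x" using sb_homog[of True ?x True "od b"] by simp
    moreover have "?x \<in> filt 0" using x gen by (auto simp: filt_0 filt_gen)
    ultimately show ?thesis using sb_filt od_filt gen by metis
  qed
  moreover have "od (scl c (xm S * vv n) + b) * od (scl c (xm S * vv n) + b)
      = scl (c * c) (?x * ?x) + scl c (?x * od b + od b * ?x) + od b * od b"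
    by (simp add: od_add od_scl algebra_simps scl_add)
  ultimately show ?case using gen by (simp add: filt_add filt_scl)
qed (simp add: filt_0)

text \<open>Every closure rule of \<open>Qalg\<close> preserves \<open>filt 0\<close>.\<close>

lemma Qalg_filt: "E \<in> Qalg \<Longrightarrow> \<exists>a\<in>filt 0. E = mat a"
proof (induction rule: Qalg.induct)
  case (gen j)
  then show ?case using vv_filt[of 0 j] by (metis vv.rep_eq zero_le)
next
  case zero
  then show ?case using filt_0 by (metis zero_op.rep_eq)
next
  case (add a b)
  then show ?case using filt_add by (metis plus_op.rep_eq)
next
  case (scale a c)
  then show ?case using filt_scl by (metis scl.rep_eq)
next
  case (br a b)
  then show ?case using sb_filt mat_sb by metis
next
  case (sq E)
  then obtain a where a: "a \<in> filt 0" "E = mat a" by blast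
  have "od a = a"
  proof (rule op_eqI)
    fix S U
    have "even_part E S U = 0" using sq by (simp add: is_odd_def)
    then show "mat (od a) S U = mat a S U"
      by (auto simp: a od.rep_eq even_part_def odd_part_def split: if_splits)
  qed
  then have "a * a \<in> filt 0" using od_sq_filt[OF a(1)] by simp
  then show ?case using a times_op.rep_eq by metis
qed

lemma opQ_subset: "opQ \<subseteq> filt 0"
  unfolding opQ_def using Qalg_filt mat_inject by (metis (no_types, lifting) mem_Collect_eq subsetI)

text \<open>The anticommutator term dies because x_n divides both x_T and [v_n, v_m]; the derivative
  term is given by \<open>Dm_mem\<close>. This is the deletion of a variable used for all
  ideals.\<close>

lemma sb_vv_mem:
  assumes "finite T" "n \<in> T" "n < m"
  shows "(sb (vv n) (xm T * vv m) :: 'a::field op) \<simeq> xm (T - {n}) * vv m"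
proof -
  obtain b :: "'a op" where b: "ac n m = lx n * b" using ac_factor[OF assms(3)] by blast
  have "xm T * lx n = (0 :: 'a op)"
    using xm_mult_zero[of T "{n}" n] assms by simp
  then have "xm T * ac n m = (0 :: 'a op)" unfolding b by (simp flip: mult.assoc)
  then have "sb (vv n) (xm T * vv m) = (Dm n T * vv m :: 'a op)"
    using sb_xm[of "{}" T m n, where ?'a='a] assms by simp
  then show ?thesis using eq_sign_mult[OF Dm_mem] assms by (metis eq_sign_refl)
qed

lemma sb_below:
  assumes "finite S" "finite T" "S \<subseteq> {..<m}" "T \<subseteq> {..<n}"
  shows "(sb (xm S * vv n) (xm T * vv m) :: 'a::field op) \<simeq> xm S * xm T * ac n m"
  using assms by (simp add: sb_xm Dm_zero eq_sign_power)

section \<open>Ideals generated by large pivots\<close>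

text \<open>Either factor of a bracket may be the one in the ideal. Taking \<open>opQ\<close> for
  \<open>J\<close> makes the same rules available for Q itself.\<close>

definition pair_mem :: "'a::field op set \<Rightarrow> nat \<Rightarrow> nat set \<Rightarrow> nat \<Rightarrow> nat set \<Rightarrow> bool" where
  "pair_mem J n S m T \<longleftrightarrow>
     xm S * vv n \<in> (opQ :: 'a op set) \<and> xm T * vv m \<in> J \<or>
     xm S * vv n \<in> J \<and> xm T * vv m \<in> (opQ :: 'a op set)"

text \<open>Instantiated with Q and with the preimages of its ideals. Squaring is assumed in
  characteristic two only; otherwise [a, a] = 2 a^2 provides it, see \<open>sq_mem\<close>.\<close>

locale q_ideal =
  fixes J :: "'a::field op set"
  assumes subset_opQ: "J \<subseteq> opQ"
    and zero_mem: "0 \<in> J"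
    and add_mem: "a \<in> J \<Longrightarrow> b \<in> J \<Longrightarrow> a + b \<in> J"
    and scl_mem: "a \<in> J \<Longrightarrow> scl c a \<in> J"
    and sb_mem: "q \<in> opQ \<Longrightarrow> a \<in> J \<Longrightarrow> sb q a \<in> J"
    and sq_mem_char2: "(2::'a) = 0 \<Longrightarrow> a \<in> J \<Longrightarrow> homog True a \<Longrightarrow> a * a \<in> J"
begin

lemma neg_mem: "a \<in> J \<Longrightarrow> - a \<in> J"
  using scl_mem[of a "- 1"] by simp

lemma eq_sign_mem: "a \<simeq> b \<Longrightarrow> a \<in> J \<Longrightarrow> b \<in> J"
  using neg_mem by (auto simp: eq_sign_def) (metis minus_minus)

lemma scl_cancel: "scl c a \<in> J \<Longrightarrow> c \<noteq> 0 \<Longrightarrow> a \<in> J"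
  using scl_mem[of "scl c a" "inverse c"] by simp

lemma sq_mem:
  assumes "a \<in> J" "homog True a" shows "a * a \<in> J"
proof (cases "(2::'a) = 0")
  case False
  have "sb a a \<in> J" using assms subset_opQ sb_mem by blast
  then have "scl 2 (a * a) \<in> J" using assms by (simp add: sb_homog[of True _ True] scl_2)
  then show ?thesis using scl_cancel False by blast
qed (use assms sq_mem_char2 in auto)

lemma del_mem:
  assumes "vv n \<in> (opQ :: 'a op set)" "finite T" "n \<in> T" "n < m" "xm T * vv m \<in> J"
  shows "xm (T - {n}) * vv m \<in> J"
  by (rule eq_sign_mem[OF sb_vv_mem[OF assms(2-4)] sb_mem[OF assms(1,5)]])

end

interpretation Q: q_ideal "opQ :: 'a::field op set"
proof
  show "0 \<in> (opQ :: 'a op set)" by (simp add: opQ_def zero_op.rep_eq Qalg.zero)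
  show "a + b \<in> opQ" if "a \<in> opQ" "b \<in> opQ" for a b :: "'a op"
    using that by (simp add: opQ_def plus_op.rep_eq Qalg.add)
  show "scl c a \<in> opQ" if "a \<in> opQ" for a :: "'a op" and c
    using that by (simp add: opQ_def scl.rep_eq Qalg.scale)
  show "sb a b \<in> opQ" if "a \<in> opQ" "b \<in> opQ" for a b :: "'a op"
    using that by (simp add: opQ_def mat_sb Qalg.br)
  show "a * a \<in> opQ" if "(2::'a) = 0" "a \<in> opQ" "homog True a" for a :: "'a op"
  proof -
    have "is_odd (mat a)"
      using ev_homog[OF that(3)] by (simp add: is_odd_def zero_op.rep_eq flip: ev.rep_eq)
    then show ?thesis using that by (simp add: opQ_def times_op.rep_eq Qalg.sq)
  qed
qed simp

text \<open>The square of v_{n-3} is x_{n-2} v_n, and the bracket with v_{n-2} removes the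
  variable.\<close>

lemma vv_opQ: "vv n \<in> (opQ :: 'a::field op set)"
proof (induction n rule: less_induct)
  case (less n)
  show ?case
  proof (cases "n < 3")
    case True
    then show ?thesis by (simp add: opQ_def vv.rep_eq Qalg.gen)
  next
    case False
    then have "vv (n - 3) \<in> (opQ :: 'a op set)" "vv (n - 2) \<in> (opQ :: 'a op set)" using less by auto
    then have "lx (n - 3 + 1) * vv (n - 3 + 3) \<in> (opQ :: 'a op set)"
      using Q.sq_mem[OF _ homog_vv, of "n - 3"] by (simp add: vv_sq)
    moreover have "n - 3 + 1 = n - 2" "n - 3 + 3 = n" using False by auto
    ultimately have "xm {n - 2} * vv n \<in> (opQ :: 'a op set)" by simp
    from Q.del_mem[OF _ _ _ _ this] \<open>vv (n - 2) \<in> (opQ :: 'a op set)\<close> False show ?thesis by simp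
  qed
qed

context q_ideal
begin

text \<open>Brackets with the pivots v_n for n in T - S delete one variable at a time; T below m
  ensures n < m for \<open>del_mem\<close>.\<close>

lemma subset_mem:
  assumes "xm T * vv m \<in> J" "S \<subseteq> T" "T \<subseteq> {..<m}"
  shows "xm S * vv m \<in> J"
proof -
  have "finite T" using assms finite_subset by blast
  have "xm (T - U) * vv m \<in> J" if "finite U" "U \<subseteq> T" for U
    using that
  proof (induction U rule: finite_induct)
    case (insert n U)
    have "xm (T - U - {n}) * vv m \<in> J"
      by (rule del_mem) (use insert assms vv_opQ \<open>finite T\<close> in auto)
    then show ?case by (simp only: Diff_insert[of T n U])
  qed (use assms in auto)
  from this[of "T - S"] have "xm (T - (T - S)) * vv m \<in> J" using \<open>finite T\<close> by blast
  moreover have "T - (T - S) = S" using assms by blast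
  ultimately show ?thesis by simp
qed

lemma pair_mem_ac:
  assumes "pair_mem J n S m T" "S \<subseteq> {..<n}" "T \<subseteq> {..<n}" "n \<le> m"
  obtains e :: "'a op" where "e \<simeq> xm (S \<union> T)" "e * ac n m \<in> J"
proof
  \<comment> \<open>Common variables would make the product vanish, so they are first deleted from
    S.\<close>
  let ?S = "S - T"
  have fin: "finite ?S" "finite T" using assms by (auto intro: finite_subset)
  show "xm ?S * xm T \<simeq> (xm (S \<union> T) :: 'a op)"
    using xm_mult[OF fin, where ?'a='a] by auto
  have "sb (xm ?S * vv n) (xm T * vv m) \<in> J"
  proof (cases "xm S * vv n \<in> (opQ :: 'a op set) \<and> xm T * vv m \<in> J")
    case True
    then show ?thesis using Q.subset_mem[of S n ?S] assms sb_mem by blast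
  next
    case False
    then have "xm ?S * vv n \<in> J" "xm T * vv m \<in> (opQ :: 'a op set)"
      using assms subset_mem[of S n ?S] by (auto simp: pair_mem_def)
    then have "sb (xm T * vv m) (xm ?S * vv n) \<in> J" by (intro sb_mem)
    then show ?thesis by (rule eq_sign_mem[OF sb_swap])
  qed
  moreover have "sb (xm ?S * vv n) (xm T * vv m) \<simeq> xm ?S * xm T * (ac n m :: 'a op)"
    using assms fin by (intro sb_below) auto
  ultimately show "xm ?S * xm T * ac n m \<in> J" using eq_sign_mem by blast
qed

text \<open>This rule and the next two enlarge variable sets by means of \<open>ac_Suc\<close>,
  \<open>ac_Suc_Suc\<close> and \<open>ac_same\<close>. The third divides by 2, whereas
  \<open>mem_sq\<close> works in every characteristic.\<close>

lemma mem_Suc: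
  assumes "pair_mem J n S (n + 1) T" "S \<subseteq> {..<n}" "T \<subseteq> {..<n}"
  shows "xm (insert n (S \<union> T)) * vv (n + 3) \<in> J"
proof -
  obtain e :: "'a op" where e: "e \<simeq> xm (S \<union> T)" "e * ac n (n + 1) \<in> J"
    by (rule pair_mem_ac[OF assms]) auto
  have "xm (insert n (S \<union> T)) = (xm (S \<union> T) * lx n :: 'a op)"
    using assms finite_subset by (intro xm_insert_max) auto
  moreover have "e * ac n (n + 1) \<simeq> xm (S \<union> T) * (lx n * vv (n + 3))"
    using e by (intro eq_sign_mult) (simp_all add: ac_Suc eq_sign_def)
  ultimately show ?thesis using eq_sign_mem e by (metis mult.assoc)
qed

lemma mem_Suc_Suc:
  assumes "pair_mem J n S (n + 2) T" "S \<subseteq> {..<n}" "T \<subseteq> {..<n}"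
  shows "xm ({n, n + 1, n + 2} \<union> (S \<union> T)) * vv (n + 5) \<in> J"
proof -
  obtain e :: "'a op" where e: "e \<simeq> xm (S \<union> T)" "e * ac n (n + 2) \<in> J"
    by (rule pair_mem_ac[OF assms]) auto
  have fin: "finite (S \<union> T)" using assms finite_subset by auto
  have "xm (insert n (S \<union> T)) = (xm (S \<union> T) * lx n :: 'a op)"
    "xm (insert (n + 1) (insert n (S \<union> T))) = (xm (insert n (S \<union> T)) * lx (n + 1) :: 'a op)"
    "xm (insert (n + 2) (insert (n + 1) (insert n (S \<union> T))))
      = (xm (insert (n + 1) (insert n (S \<union> T))) * lx (n + 2) :: 'a op)"
    using assms fin by (intro xm_insert_max; fastforce)+
  moreover have "insert (n + 2) (insert (n + 1) (insert n (S \<union> T))) = {n, n + 1, n + 2} \<union> (S \<union> T)"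
    by auto
  ultimately have x: "xm ({n, n + 1, n + 2} \<union> (S \<union> T)) = (xm (S \<union> T) * lx n * lx (n + 1) * lx (n + 2) :: 'a op)"
    by metis
  have "e * ac n (n + 2) \<simeq> xm (S \<union> T) * (lx n * (lx (n + 1) * (lx (n + 2) * vv (n + 5))))"
    using e unfolding ac_Suc_Suc by (intro eq_sign_mult) (simp_all add: eq_sign_def)
  from eq_sign_mem[OF this e(2)] show ?thesis unfolding x by (simp only: mult.assoc)
qed

lemma mem_same:
  assumes "pair_mem J n S n T" "S \<subseteq> {..<n}" "T \<subseteq> {..<n}" "(2::'a) \<noteq> 0"
  shows "xm (insert (n + 1) (S \<union> T)) * vv (n + 3) \<in> J"
proof -
  obtain e :: "'a op" where e: "e \<simeq> xm (S \<union> T)" "e * ac n n \<in> J"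
    by (rule pair_mem_ac[OF assms(1-3)]) auto
  have "xm (insert (n + 1) (S \<union> T)) = (xm (S \<union> T) * lx (n + 1) :: 'a op)"
    using assms finite_subset by (intro xm_insert_max) fastforce+
  moreover have "e * (lx (n + 1) * vv (n + 3)) \<simeq> xm (S \<union> T) * (lx (n + 1) * vv (n + 3))"
    using e by (intro eq_sign_mult) auto
  moreover have "e * (lx (n + 1) * vv (n + 3)) \<in> J"
    using e(2) assms(4) scl_cancel by (simp add: ac_same)
  ultimately show ?thesis using eq_sign_mem by (metis mult.assoc)
qed

lemma mem_sq: "vv n \<in> J \<Longrightarrow> xm {n + 1} * vv (n + 3) \<in> J"
  using sq_mem[OF _ homog_vv, of n] by (simp add: vv_sq)

end

text \<open>Brackets of v_{m-3} with the monomial at m - 2 add the index m - 3 to m - 5, m - 7,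
  ...\<close>

lemma alternating_opQ: "xm {i. i + 3 \<le> m \<and> odd (m - i)} * vv m \<in> (opQ :: 'a::field op set)"
proof (induction m rule: less_induct)
  case (less m)
  show ?case
  proof (cases "m < 3")
    case True
    then have "{i. i + 3 \<le> m \<and> odd (m - i)} = {}" by auto
    then show ?thesis using vv_opQ by (simp only: xm_empty mult_1_left)
  next
    case False
    then obtain n where m: "m = n + 3" by (metis add.commute le_Suc_ex not_less)
    let ?T = "{i. i + 3 \<le> n + 1 \<and> odd (n + 1 - i)}"
    have "pair_mem (opQ :: 'a op set) n {} (n + 1) ?T"
      using less[of "n + 1"] vv_opQ[of n] by (simp add: pair_mem_def m)
    then have "xm (insert n ({} \<union> ?T)) * vv (n + 3) \<in> (opQ :: 'a op set)"
      by (rule Q.mem_Suc) auto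
    moreover have "insert n ({} \<union> ?T) = {i. i + 3 \<le> m \<and> odd (m - i)}"
      unfolding m by (auto simp: Suc_diff_le) presburger+
    ultimately show ?thesis by (simp add: m)
  qed
qed

text \<open>With n = m - 3, the alternating sets at n and n + 1 have opposite parities and together
  fill all indices up to n - 2; the bracket adds n. Only m - 4 is missing below m - 2.\<close>

lemma full_opQ:
  assumes "S \<subseteq> {i. i + 5 \<le> m \<or> i + 3 = m}" shows "xm S * vv m \<in> (opQ :: 'a::field op set)"
proof (cases "m < 3")
  case True
  then have "S = {}" using assms by auto
  then show ?thesis using vv_opQ by simp
next
  case False
  then obtain n where m: "m = n + 3" by (metis add.commute le_Suc_ex not_less)
  let ?S = "{i. i + 3 \<le> n \<and> odd (n - i)}" and ?T = "{i. i + 3 \<le> n + 1 \<and> odd (n + 1 - i)}"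
  have "xm (insert n (?S \<union> ?T)) * vv (n + 3) \<in> (opQ :: 'a op set)"
    by (rule Q.mem_Suc) (use alternating_opQ[of n] alternating_opQ[of "n + 1"] in \<open>auto simp: pair_mem_def\<close>)
  moreover have "S \<subseteq> insert n (?S \<union> ?T)"
  proof
    fix i assume "i \<in> S"
    then have i: "i + 2 \<le> n \<or> i = n" using assms m by auto
    show "i \<in> insert n (?S \<union> ?T)"
    proof (cases "i = n")
      case False
      then have *: "i + 2 \<le> n" using i by simp
      show ?thesis
      proof (cases "odd (n - i)")
        case True
        then have "i + 3 \<le> n" using * by (cases "n = i + 2") auto
        then show ?thesis using True by simp
      qed (use * in \<open>auto simp: Suc_diff_le\<close>)
    qed simp
  qed
  ultimately show ?thesis unfolding m by (rule Q.subset_mem) auto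
qed

context q_ideal
begin

context
  fixes N :: nat
  assumes vv_mem: "\<And>n. N \<le> n \<Longrightarrow> vv n \<in> J"
begin

text \<open>With n = m - 7, v_{n+2} in J and x_n v_{n+3} in Q give x_n x_{n+2} v_{n+5} in J. These
  two variables are the ones up to n + 2 that the monomial of \<open>full_opQ\<close> at n + 4
  lacks, and the final bracket adds n + 4.\<close>

lemma full_mem:
  assumes "N + 7 \<le> m" "S \<subseteq> {i. i + 5 \<le> m \<or> i + 3 = m}" shows "xm S * vv m \<in> J"
proof -
  define n where "n = m - 7"
  have m: "m = n + 7" and n: "N \<le> n" using assms by (auto simp: n_def)
  have "xm {n} * vv (n + 3) \<in> (opQ :: 'a op set)" by (rule full_opQ) auto
  then have "pair_mem J (n + 2) {} (n + 2 + 1) {n}"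
    using vv_mem[of "n + 2"] n by (simp add: pair_mem_def numeral_eq_Suc)
  then have "xm (insert (n + 2) ({} \<union> {n})) * vv (n + 2 + 3) \<in> J"
    by (rule mem_Suc) auto
  moreover have "xm {i. i + 5 \<le> n + 4 \<or> i + 3 = n + 4} * vv (n + 4) \<in> (opQ :: 'a op set)" by (rule full_opQ) auto
  ultimately have "pair_mem J (n + 4) {i. i + 5 \<le> n + 4 \<or> i + 3 = n + 4} (n + 4 + 1) {n + 2, n}"
    by (simp add: pair_mem_def)
  then have "xm (insert (n + 4) ({i. i + 5 \<le> n + 4 \<or> i + 3 = n + 4} \<union> {n + 2, n})) * vv (n + 4 + 3) \<in> J"
    by (rule mem_Suc) auto
  moreover have "n + 4 + 3 = m" using m by simp
  ultimately have "xm (insert (n + 4) ({i. i + 5 \<le> n + 4 \<or> i + 3 = n + 4} \<union> {n + 2, n})) * vv m \<in> J"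
    by (simp only:)
  then show ?thesis by (rule subset_mem) (use assms(2) in \<open>auto simp: m\<close>)
qed

text \<open>With n = m - 9, x_n ... x_{n+3} v_{n+6} lies in Q and the monomial of
  \<open>full_mem\<close> at n + 4 in J. Their bracket adds n + 4, n + 5, n + 6, so every index up
  to m - 3 occurs.\<close>

lemma initial_mem:
  assumes "N + 12 \<le> m" "S \<subseteq> {i. i + 3 \<le> m}" shows "xm S * vv m \<in> J"
proof -
  define n where "n = m - 9"
  have m: "m = n + 9" and n: "N + 3 \<le> n" using assms by (auto simp: n_def)
  have "xm {n} * vv (n + 3) \<in> (opQ :: 'a op set)" by (rule full_opQ) auto
  then have "pair_mem (opQ :: 'a op set) (n + 1) {} (n + 1 + 2) {n}"
    using vv_opQ by (simp add: pair_mem_def numeral_eq_Suc)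
  then have "xm ({n + 1, n + 1 + 1, n + 1 + 2} \<union> ({} \<union> {n})) * vv (n + 1 + 5) \<in> (opQ :: 'a op set)"
    by (rule Q.mem_Suc_Suc) auto
  then have "pair_mem J (n + 4) {i. i + 5 \<le> n + 4 \<or> i + 3 = n + 4} (n + 4 + 2)
      ({n + 1, n + 1 + 1, n + 1 + 2} \<union> ({} \<union> {n}))"
    using full_mem[of "n + 4"] n by (simp add: pair_mem_def add_ac)
  then have "xm ({n + 4, n + 4 + 1, n + 4 + 2} \<union> ({i. i + 5 \<le> n + 4 \<or> i + 3 = n + 4} \<union>
      ({n + 1, n + 1 + 1, n + 1 + 2} \<union> ({} \<union> {n})))) * vv (n + 4 + 5) \<in> J"
    by (rule mem_Suc_Suc) auto
  then have "xm ({n + 4, n + 4 + 1, n + 4 + 2} \<union> ({i. i + 5 \<le> n + 4 \<or> i + 3 = n + 4} \<union>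
      ({n + 1, n + 1 + 1, n + 1 + 2} \<union> ({} \<union> {n})))) * vv m \<in> J"
    using m by (simp add: add_ac)
  then show ?thesis by (rule subset_mem) (use assms(2) in \<open>auto simp: m\<close>)
qed

text \<open>A factor x_{m-2} has two sources: the square of v_{m-3} gives it alone, and outside
  characteristic two a bracket of two monomials at m - 3 gives it together with all indices up to m
  - 5.\<close>

lemma adm_mem:
  assumes "N + 15 \<le> m" "adm ((2::'a) = 0) m S" shows "xm S * vv m \<in> J"
proof -
  define n where "n = m - 3"
  have m: "m = n + 3" and n: "N + 12 \<le> n" using assms by (auto simp: n_def)
  consider "\<forall>i\<in>S. i + 3 \<le> m" | "S = {n + 1}" | "n + 1 \<in> S" "(2::'a) \<noteq> 0"
  proof (cases "n + 1 \<in> S")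
    case True
    then have "\<forall>j\<in>S. j \<noteq> n + 1 \<longrightarrow> (2::'a) \<noteq> 0" using assms(2) by (auto simp: adm_def m)
    then show ?thesis using True that(2,3) by blast
  next
    case False
    have "i + 3 \<le> m" if "i \<in> S" for i
    proof -
      have "i + 2 \<le> m" using that assms(2) by (auto simp: adm_def)
      moreover have "i \<noteq> n + 1" using that False by blast
      ultimately show ?thesis using m by linarith
    qed
    then show ?thesis using that(1) by blast
  qed
  then show ?thesis
  proof cases
    case 1
    then show ?thesis using assms by (intro initial_mem) auto
  next
    case 2
    then show ?thesis using mem_sq[OF vv_mem, of n] n by (simp add: m)
  next
    case 3
    \<comment> \<open>This is the square of v_{n-3}; it contributes the index n - 2 = m - 5 that the
      initial monomial at n lacks.\<close>
    have "xm {n - 2} * vv n \<in> (opQ :: 'a op set)"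
      using Q.mem_sq[OF vv_opQ, of "n - 3"] n by (simp add: Suc_diff_Suc numeral_eq_Suc)
    then have "pair_mem J n {i. i + 3 \<le> n} n {n - 2}"
      using initial_mem[of n] n by (simp add: pair_mem_def)
    then have "xm (insert (n + 1) ({i. i + 3 \<le> n} \<union> {n - 2})) * vv (n + 3) \<in> J"
      by (rule mem_same) (use n 3 in auto)
    moreover have "S \<subseteq> insert (n + 1) ({i. i + 3 \<le> n} \<union> {n - 2})"
      using 3 assms(2) unfolding adm_def m by fastforce
    ultimately show ?thesis unfolding m by (rule subset_mem) auto
  qed
qed

end

end

section \<open>Every nonzero ideal contains all large pivots\<close>

lemma vv_kills:
  assumes "\<forall>t. t |\<in>| T \<longrightarrow> t < n"
  shows "mat (vv n) T U = 0"
proof -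
  have "n + 3 * k |\<notin>| T" for k using assms by force
  then show ?thesis
    by (simp add: mat_vv[OF assms] vtrunc_def mat_sum mat_times_dd)
qed

text \<open>Each monomial x_T is thus killed by all sufficiently high levels, so their intersection
  is 0 and a nonzero element has a lowest pivot.\<close>

lemma filt_kills:
  assumes "a \<in> filt p" "\<forall>t. t |\<in>| T \<longrightarrow> t < p"
  shows "mat a T U = 0"
  using assms(1)
proof (induction rule: filt_induct)
  case (gen c S n b)
  have "\<forall>t. t |\<in>| T \<longrightarrow> t < n" using assms(2) gen(1) by fastforce
  then show ?case using gen by (simp add: mat_times vv_kills)
qed simp

lemma filt_leading:
  assumes "(a :: 'a::field op) \<in> filt p"
  shows "\<exists>c t. t \<in> filt (p + 1) \<and> a = (\<Sum>S\<in>Pow {..<p}. scl (c S) (xm S * vv p)) + t \<and>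
    (\<forall>S. c S \<noteq> 0 \<longrightarrow> adm ((2::'a) = 0) p S)"
  using assms
proof (induction rule: filt_induct)
  case zero
  show ?case by (intro exI[of _ "\<lambda>_. 0"] exI[of _ 0]) (simp add: filt_0)
next
  case (gen e S n b)
  then obtain c t where t: "t \<in> filt (p + 1)" and b: "b = (\<Sum>S\<in>Pow {..<p}. scl (c S) (xm S * vv p)) + t"
    and c: "\<forall>S. c S \<noteq> 0 \<longrightarrow> adm ((2::'a) = 0) p S" by blast
  show ?case
  proof (cases "n = p")
    case True
    let ?c = "\<lambda>T. (if T = S then e else 0) + c T"
    have "S \<in> Pow {..<p}" using gen True by (auto simp: adm_def)
    then have "(\<Sum>T\<in>Pow {..<p}. scl (if T = S then e else 0) (xm T * vv p)) = scl e (xm S * vv p :: 'a op)"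
      by (subst sum.remove[of _ S]) auto
    then have "scl e (xm S * vv n) + b = (\<Sum>S\<in>Pow {..<p}. scl (?c S) (xm S * vv p)) + t"
      by (simp add: b True scl_add_left sum.distrib add.assoc)
    moreover have "\<forall>T. ?c T \<noteq> 0 \<longrightarrow> adm ((2::'a) = 0) p T" using c gen True by auto
    ultimately show ?thesis using t by (intro exI[of _ ?c] exI[of _ t]) simp
  next
    case False
    then have "scl e (xm S * vv n) + t \<in> filt (p + 1)" using gen t by (intro filt_add filt_scl filt_gen) auto
    moreover have "scl e (xm S * vv n) + b
        = (\<Sum>S\<in>Pow {..<p}. scl (c S) (xm S * vv p)) + (scl e (xm S * vv n) + t)"
      by (simp add: b algebra_simps)
    ultimately show ?thesis using c by blast
  qed
qed

text \<open>m is the last level containing a; if all leading coefficients vanished, a would lie in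
  \<open>filt (m + 1)\<close>.\<close>

lemma filt_nonzero_leading:
  assumes "(a :: 'a::field op) \<in> filt 0" "a \<noteq> 0"
  shows "\<exists>m c t S. t \<in> filt (m + 1) \<and> a = (\<Sum>S\<in>Pow {..<m}. scl (c S) (xm S * vv m)) + t \<and>
    (\<forall>S. c S \<noteq> 0 \<longrightarrow> adm ((2::'a) = 0) m S) \<and> S \<subseteq> {..<m} \<and> c S \<noteq> 0"
proof -
  obtain T U where TU: "mat a T U \<noteq> 0" using assms(2) op_eqI[of a 0] by auto
  obtain n where "\<forall>t. t |\<in>| T \<longrightarrow> t < n" using fset_bounded by blast
  then have n: "a \<notin> filt n" using filt_kills TU by blast
  define p where "p = (LEAST p. a \<notin> filt p)"
  have p: "a \<notin> filt p" unfolding p_def using n by (rule LeastI)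
  then obtain m where m: "p = Suc m" using assms(1) by (cases p) auto
  have "a \<in> filt m" using not_less_Least[of m "\<lambda>p. a \<notin> filt p"] m by (auto simp: p_def)
  then obtain c t where *: "t \<in> filt (m + 1)" "a = (\<Sum>S\<in>Pow {..<m}. scl (c S) (xm S * vv m)) + t"
    "\<forall>S. c S \<noteq> 0 \<longrightarrow> adm ((2::'a) = 0) m S" using filt_leading by blast
  have "\<exists>S\<in>Pow {..<m}. c S \<noteq> 0"
  proof (rule ccontr)
    assume "\<not> ?thesis"
    then have "a = t" using *(2) by simp
    then show False using * p m by simp
  qed
  then show ?thesis using * by blast
qed

lemma filt_sum: "(\<And>i. i \<in> A \<Longrightarrow> f i \<in> filt p) \<Longrightarrow> sum f A \<in> filt p"
  by (induction A rule: infinite_finite_induct) (auto intro: filt_0 filt_add)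

lemma adm_subset: "adm c m T \<Longrightarrow> S \<subseteq> T \<Longrightarrow> adm c m S"
  unfolding adm_def by (meson finite_subset subsetD)

lemma sb_sum_right: "sb a (sum f A) = (\<Sum>i\<in>A. sb a (f i))"
  by (induction A rule: infinite_finite_induct) (auto simp: sb_add_right)

text \<open>The anticommutator only contributes higher pivots. Modulo these, the bracket with v_k
  acts on the coefficient of v_m as a superderivation.\<close>

lemma sb_vv_lead:
  assumes "adm ((2::'a::field) = 0) m S" "k \<le> m"
  shows "(sb (vv k) (xm S * vv m) :: 'a op) - Dm k S * vv m \<in> filt (m + 1)"
proof -
  have "finite S" using assms by (simp add: adm_def)
  then show ?thesis
    using ac_filt[OF adm_empty assms] sb_xm[of "{}" S m k, where ?'a='a] by (simp add: filt_scl)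
qed

context q_ideal
begin

text \<open>Induction on the number k of variables allowed in the leading coefficient. If the top
  variable occurs, the bracket with its pivot removes it from the terms containing it and kills the
  other leading terms, so some coefficient stays nonzero.\<close>

lemma leading_vv:
  assumes "a \<in> J" "k \<le> m" "t \<in> filt (m + 1)" "a = (\<Sum>S\<in>Pow {..<k}. scl (c S) (xm S * vv m)) + t"
    "\<forall>S. c S \<noteq> 0 \<longrightarrow> adm ((2::'a) = 0) m S" "S \<subseteq> {..<k}" "c S \<noteq> 0"
  shows "\<exists>a\<in>J. \<exists>e t. e \<noteq> 0 \<and> t \<in> filt (m + 1) \<and> a = scl e (vv m) + t"
  using assms
proof (induction k arbitrary: a c t S)
  case 0
  then show ?case by auto
next
  case (Suc k)
  let ?P = "Pow {..<k}"
  have inj: "inj_on (insert k) ?P"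
    by (rule inj_onI) (metis PowD insert_ident lessThan_iff less_irrefl subsetD)
  have dis: "?P \<inter> insert k ` ?P = {}" by auto
  have P: "Pow {..<Suc k} = ?P \<union> insert k ` ?P" by (simp add: lessThan_Suc Pow_insert)
  have split: "sum f (Pow {..<Suc k}) = sum f ?P + (\<Sum>S\<in>?P. f (insert k S))" for f :: "nat set \<Rightarrow> 'a op"
    unfolding P by (subst sum.union_disjoint) (use dis in \<open>auto simp: sum.reindex[OF inj]\<close>)
  show ?case
  proof (cases "\<exists>S\<in>?P. c (insert k S) \<noteq> 0")
    case False
    then have "(\<Sum>S\<in>?P. scl (c (insert k S)) (xm (insert k S) * vv m)) = (0 :: 'a op)" by simp
    then have "a = (\<Sum>S\<in>?P. scl (c S) (xm S * vv m)) + t" using Suc.prems(4) unfolding split by simp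
    moreover have "S \<in> ?P"
    proof (rule ccontr)
      assume "S \<notin> ?P"
      moreover have "S \<in> ?P \<union> insert k ` ?P" using Suc.prems(6) unfolding P[symmetric] by blast
      ultimately show False using False Suc.prems(7) by blast
    qed
    ultimately show ?thesis using Suc by (intro Suc.IH[of a t c S]) auto
  next
    case True
    then obtain S' where S': "S' \<subseteq> {..<k}" "c (insert k S') \<noteq> 0" by auto
    \<comment> \<open>By \<open>Dm_max\<close>, bracketing with v_k turns the leading term x_S x_k
      v_m into (-1)^|S| x_S v_m.\<close>
    let ?c = "\<lambda>S. if S \<subseteq> {..<k} then c (insert k S) * (- 1) ^ card S else 0"
    let ?f = "\<lambda>S. scl (c S) (xm S * vv m) :: 'a op" and ?g = "\<lambda>S. scl (?c S) (xm S * vv m) :: 'a op"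
    \<comment> \<open>Collected here are the images of terms without x_k, the errors beyond the
      leading terms, and the image of the old remainder.\<close>
    define t' where "t' = (\<Sum>S\<in>?P. sb (vv k) (?f S)) + (\<Sum>S\<in>?P. sb (vv k) (?f (insert k S)) - ?g S) + sb (vv k) t"
    have lead: "scl (c S) (sb (vv k) (xm S * vv m) - Dm k S * vv m) \<in> filt (m + 1)" for S
      using sb_vv_lead[of m S k, where ?'a='a] Suc.prems(2,5) filt_scl[of _ "m + 1" "c S"]
      by (cases "c S = 0") (auto simp: filt_0)
    have "sb (vv k) (?f S) \<in> filt (m + 1)" if "S \<in> ?P" for S
    proof -
      have "finite S" "S \<subseteq> {..<k}" using that finite_subset by auto
      then show ?thesis using lead[of S] by (simp add: Dm_zero sb_scl_right)
    qed
    moreover have "sb (vv k) (?f (insert k S)) - ?g S \<in> filt (m + 1)" if "S \<in> ?P" for S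
    proof -
      have "finite S" "S \<subseteq> {..<k}" using that finite_subset by auto
      then show ?thesis using lead[of "insert k S"] by (simp add: Dm_max sb_scl_right scl_diff)
    qed
    moreover have "sb (vv k) t \<in> filt (m + 1)" using Suc.prems by (intro sb_vv_filt) auto
    ultimately have t': "t' \<in> filt (m + 1)" unfolding t'_def by (intro filt_add filt_sum) auto
    have "sb (vv k) a = sum ?g ?P + t'"
      unfolding Suc.prems(4) sb_add_right sb_sum_right split t'_def by (simp add: sum_subtractf)
    moreover have "sb (vv k) a \<in> J" using vv_opQ Suc.prems by (intro sb_mem)
    moreover have "\<forall>S. ?c S \<noteq> 0 \<longrightarrow> adm ((2::'a) = 0) m S"
      using Suc.prems(5) adm_subset[of _ m "insert k S" S for S] by auto
    ultimately show ?thesis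
      using Suc.prems(2) t' S' by (intro Suc.IH[of "sb (vv k) a" t' ?c S']) auto
  qed
qed

end

text \<open>The elements of \<open>tail p\<close> are annihilated by \<open>x\<^bsub>p-3\<^esub> x\<^bsub>p-2\<^esub>\<close>.\<close>

definition tail :: "nat \<Rightarrow> 'a::field op set" where
  "tail p = op.span {xm U * vv r | U r. U \<subseteq> {..<p + 3} \<and> p < r \<and> r \<le> p + 3 \<and> (\<exists>i\<in>U. i + 3 = p \<or> i + 2 = p)}"

lemma tail_closed: "0 \<in> tail p" "a \<in> tail p \<Longrightarrow> b \<in> tail p \<Longrightarrow> a + b \<in> tail p" "a \<in> tail p \<Longrightarrow> scl c a \<in> tail p"
  "a \<simeq> b \<Longrightarrow> b \<in> tail p \<Longrightarrow> a \<in> tail p"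
  unfolding tail_def eq_sign_def
  by (auto intro: op.span_zero op.span_add op.span_scale op.span_neg)

text \<open>For p at least n + 2 the bracket of x_m v_p with x_S v_n has no derivative terms, and
  \<open>ac_structure\<close> puts x_{p-3} or x_{p-2} into [v_n, v_p]. Finitely many monomials in t
  give a common threshold q.\<close>

lemma sb_lx_vv_tail:
  assumes "(t :: 'a::field op) \<in> filt (m + 1)"
  shows "\<exists>q. \<forall>p\<ge>q. sb (lx m * vv p) t \<in> tail p"
  using assms
proof (induction rule: filt_induct)
  case zero
  then show ?case by (simp add: tail_closed)
next
  case (gen c S n b)
  then obtain q where q: "\<forall>p\<ge>q. sb (lx m * vv p) b \<in> tail p" by blast
  have "sb (lx m * vv p) (xm S * vv n :: 'a op) \<in> tail p" if np: "n + 2 \<le> p" for p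
  proof -
    have S: "finite S" "S \<subseteq> {..<p}" "\<forall>i\<in>S. i + 2 \<le> n" using gen np by (auto simp: adm_def)
    have mn: "m < n" using gen by simp
    obtain c R r where ac: "(ac n p :: 'a op) = scl c (xm R * vv r)" and
      R: "\<forall>i\<in>R. n \<le> i \<and> i + 2 \<le> r" and r: "p + 2 \<le> r" "r \<le> p + 3" and
      R': "n + 2 \<le> p \<longrightarrow> (\<exists>i\<in>R. i + 3 = p \<or> i + 2 = p)"
      using ac_structure[of n p, where ?'a='a, OF add_leD1[OF np]]
      by (elim exE conjE) (rule that, assumption+)
    have "R \<subseteq> {..r}" using R by auto
    then have finR: "finite R" using finite_subset by blast
    have "sb (xm {m} * vv p) (xm S * vv n :: 'a op) \<simeq> sb (xm S * vv n) (xm {m} * vv p)"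
      by (rule sb_swap)
    also have "\<dots> \<simeq> xm S * xm {m} * ac n p"
      using S mn by (intro sb_below) auto
    finally have e: "sb (lx m * vv p) (xm S * vv n :: 'a op) \<simeq> scl c (xm S * xm {m} * xm R * vv r)"
      by (simp add: ac mult.assoc)
    have z: "xm S * xm {m} * xm R * vv r \<in> (tail p :: 'a op set)"
    proof (cases "m \<in> S")
      case True
      then have "xm S * xm {m} = (0 :: 'a op)" using S xm_mult_zero[of S "{m}" m] by blast
      then show ?thesis by (simp only: mult_zero_left tail_closed)
    next
      case False
      \<comment> \<open>R starts at n, while m and all of S are smaller.\<close>
      have "(S \<union> {m}) \<inter> R = {}" using S R mn by force
      then have "xm S * xm {m} * xm R * vv r \<simeq> (xm (S \<union> {m} \<union> R) * vv r :: 'a op)"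
        using eq_sign_trans[OF eq_sign_mult[OF xm_mult eq_sign_refl] xm_mult, of S "{m}" R] S finR False
        by (intro eq_sign_mult) auto
      moreover have "xm (S \<union> {m} \<union> R) * vv r \<in> (tail p :: 'a op set)"
        unfolding tail_def
      proof (rule op.span_base, intro CollectI exI conjI)
        show "S \<union> {m} \<union> R \<subseteq> {..<p + 3}" using S R r mn np by fastforce
        show "\<exists>i\<in>S \<union> {m} \<union> R. i + 3 = p \<or> i + 2 = p" using R' np by blast
      qed (use r in auto)
      ultimately show ?thesis by (rule tail_closed(4))
    qed
    show ?thesis by (rule tail_closed(4)[OF e tail_closed(3)[OF z]])
  qed
  then have "\<forall>p\<ge>max q (n + 2). sb (lx m * vv p) (scl c (xm S * vv n) + b) \<in> tail p"
    using q by (auto simp: sb_add_right sb_scl_right intro!: tail_closed(2,3))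
  then show ?case by blast
qed

text \<open>Since r > p + 3, v_r does not act on x_p x_{p+1} x_{p+3}; only the anticommutator term
  remains, and x_p or x_{p+1} occurs in it twice.\<close>

lemma sb_tail:
  assumes "(z :: 'a::field op) \<in> tail (p + 3)"
  shows "sb (xm {p, p + 1, p + 3} * vv (p + 6)) z = 0"
  using assms unfolding tail_def
proof (induction rule: op.span_induct_alt)
  case (step c x y)
  then obtain U r where x: "x = xm U * vv r" and U: "U \<subseteq> {..<p + 6}" "p + 3 < r" "r \<le> p + 6"
    "p \<in> U \<or> p + 1 \<in> U" by (auto simp: add_ac)
  have "finite U" using U finite_subset by blast
  then have "xm U * xm {p, p + 1, p + 3} = (0 :: 'a op)"
    using U(4) xm_mult_zero[of U "{p, p + 1, p + 3}"] by blast
  moreover have "sb (xm {p, p + 1, p + 3} * vv (p + 6)) x \<simeq> sb x (xm {p, p + 1, p + 3} * vv (p + 6))"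
    unfolding x by (rule sb_swap)
  moreover have "sb x (xm {p, p + 1, p + 3} * vv (p + 6)) \<simeq> xm U * xm {p, p + 1, p + 3} * (ac r (p + 6) :: 'a op)"
    unfolding x using U \<open>finite U\<close> by (intro sb_below) auto
  ultimately have "sb (xm {p, p + 1, p + 3} * vv (p + 6)) x = 0" by (auto simp: eq_sign_def)
  then show ?case using step by (simp add: sb_add_right sb_scl_right)
qed simp

context q_ideal
begin

lemma eventually_vv:
  assumes "J \<noteq> {0}" obtains N where "\<And>n. N \<le> n \<Longrightarrow> vv n \<in> J"
proof -
  obtain a0 where "a0 \<in> J" "a0 \<noteq> 0" using assms zero_mem by blast
  then have "a0 \<in> filt 0" using subset_opQ opQ_subset by blast
  obtain m c t S where "t \<in> filt (m + 1)" "a0 = (\<Sum>S\<in>Pow {..<m}. scl (c S) (xm S * vv m)) + t"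
    "\<forall>S. c S \<noteq> 0 \<longrightarrow> adm ((2::'a) = 0) m S" "S \<subseteq> {..<m}" "c S \<noteq> 0"
    using filt_nonzero_leading[OF \<open>a0 \<in> filt 0\<close> \<open>a0 \<noteq> 0\<close>] by (elim exE conjE) (rule that, assumption+)
  then have "\<exists>a\<in>J. \<exists>e t. e \<noteq> 0 \<and> t \<in> filt (m + 1) \<and> a = scl e (vv m) + t"
    by (rule leading_vv[OF \<open>a0 \<in> J\<close> order_refl])
  then obtain a e t where a: "a \<in> J" "e \<noteq> 0" "t \<in> filt (m + 1)" "a = scl e (vv m) + t" by blast
  obtain q where q: "\<forall>p\<ge>q. sb (lx m * vv p) t \<in> tail p" using sb_lx_vv_tail[OF a(3)] by blast
  have *: "vv (p + 6) \<in> J" if p: "q \<le> p" "m + 2 \<le> p" for p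
  proof -
    let ?F = "{p, p + 1, p + 3}"
    \<comment> \<open>The index m is at most p - 2 = (p + 3) - 5, within the range of
      \<open>full_opQ\<close>. All pivots are shifted by 3 to match \<open>sb_tail\<close>.\<close>
    have "xm {m} * vv (p + 3) \<in> (opQ :: 'a op set)" by (rule full_opQ) (use p in auto)
    then have b: "sb (lx m * vv (p + 3)) a \<in> J" using a by (intro sb_mem) auto
    define z where "z = sb (lx m * vv (p + 3)) t"
    have z: "z \<in> tail (p + 3)" using q p by (auto simp: z_def)
    have "sb (xm {m} * vv (p + 3)) (xm {} * vv m :: 'a op) \<simeq> sb (xm {} * vv m) (xm {m} * vv (p + 3))"
      by (rule sb_swap)
    also have "\<dots> \<simeq> vv (p + 3)" using sb_vv_mem[of "{m}" m "p + 3"] p by simp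
    finally obtain e1 where e1: "e1 = 1 \<or> e1 = - 1" "sb (lx m * vv (p + 3)) (vv m :: 'a op) = scl e1 (vv (p + 3))"
      by (auto elim: eq_signE)
    \<comment> \<open>The indices p and p + 1 are at most (p + 6) - 5, and p + 3 = (p + 6) -
      3.\<close>
    have F: "xm ?F * vv (p + 6) \<in> (opQ :: 'a op set)" by (rule full_opQ) auto
    have "sb (xm ?F * vv (p + 6)) (xm {} * vv (p + 3) :: 'a op) \<simeq> sb (xm {} * vv (p + 3)) (xm ?F * vv (p + 6))"
      by (rule sb_swap)
    also have "\<dots> \<simeq> xm (?F - {p + 3}) * vv (p + 6)"
      using sb_vv_mem[of ?F "p + 3" "p + 6", where ?'a='a] by simp
    finally have s: "sb (xm ?F * vv (p + 6)) (vv (p + 3) :: 'a op) \<simeq> xm (?F - {p + 3}) * vv (p + 6)" by simp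
    have "sb (lx m * vv (p + 3)) a = scl (e * e1) (vv (p + 3)) + z"
      by (simp add: a(4) sb_add_right sb_scl_right e1 z_def)
    then have "sb (xm ?F * vv (p + 6)) (sb (lx m * vv (p + 3)) a) = scl (e * e1) (sb (xm ?F * vv (p + 6)) (vv (p + 3)))"
      by (simp only: sb_add_right sb_scl_right sb_tail[OF z] add_0_right)
    then have "scl (e * e1) (sb (xm ?F * vv (p + 6)) (vv (p + 3))) \<in> J" using sb_mem[OF F b] by simp
    then have "sb (xm ?F * vv (p + 6)) (vv (p + 3)) \<in> J" by (rule scl_cancel) (use a(2) e1(1) in auto)
    then have "xm (?F - {p + 3}) * vv (p + 6) \<in> J" by (rule eq_sign_mem[OF s])
    then have "xm {} * vv (p + 6) \<in> J" by (rule subset_mem) auto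
    then show ?thesis by simp
  qed
  have "vv n \<in> J" if "q + m + 8 \<le> n" for n
    using *[of "n - 6"] that by simp
  then show ?thesis using that by blast
qed

end

section \<open>Just infiniteness\<close>

lemma q_ideal_of_is_ideal:
  assumes "is_ideal (I :: 'a::field endo set)"
  shows "q_ideal {a. mat a \<in> I}"
proof
  have sub: "I \<subseteq> Qalg" "endo.subspace I" "\<forall>q\<in>Qalg. \<forall>a\<in>I. sbr q a \<in> I"
    "(1::'a) + 1 = 0 \<longrightarrow> (\<forall>a\<in>I. is_odd a \<longrightarrow> ecomp a a \<in> I)"
    using assms by (auto simp: is_ideal_def)
  show "{a. mat a \<in> I} \<subseteq> opQ" using sub by (auto simp: opQ_def)
  show "0 \<in> {a. mat a \<in> I}" using sub endo.subspace_0 by (simp add: zero_op.rep_eq)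
  show "a + b \<in> {a. mat a \<in> I}" if "a \<in> {a. mat a \<in> I}" "b \<in> {a. mat a \<in> I}" for a b
    using that sub endo.subspace_add by (simp add: plus_op.rep_eq)
  show "scl c a \<in> {a. mat a \<in> I}" if "a \<in> {a. mat a \<in> I}" for a c
    using that sub endo.subspace_scale by (simp add: scl.rep_eq)
  show "sb q a \<in> {a. mat a \<in> I}" if "q \<in> opQ" "a \<in> {a. mat a \<in> I}" for q a
    using that sub by (simp add: mat_sb opQ_def)
  show "a * a \<in> {a. mat a \<in> I}" if "(2::'a) = 0" "a \<in> {a. mat a \<in> I}" "homog True a" for a
  proof -
    have "is_odd (mat a)"
      using ev_homog[OF that(3)] by (simp add: is_odd_def zero_op.rep_eq flip: ev.rep_eq)
    then show ?thesis using that sub by (simp add: times_op.rep_eq)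
  qed
qed

lemma ideal_fin_codim:
  assumes "is_ideal (I :: 'a::field endo set)" "I \<noteq> {0}"
  shows "fin_codim I (Qalg :: 'a endo set)"
proof -
  let ?J = "{a. mat a \<in> I}"
  interpret q_ideal ?J by (rule q_ideal_of_is_ideal[OF assms(1)])
  have "0 \<in> I" using zero_mem by (simp add: zero_op.rep_eq)
  then obtain E where E: "E \<in> I" "E \<noteq> 0" using assms(2) by blast
  then obtain a where "E = mat a" using Qalg_filt assms(1) by (auto simp: is_ideal_def)
  then have "a \<in> ?J" "a \<noteq> 0" using E by (auto simp: zero_op.rep_eq)
  then have "?J \<noteq> {0}" by blast
  then obtain N where N: "\<And>n. N \<le> n \<Longrightarrow> vv n \<in> ?J" using eventually_vv by blast
  \<comment> \<open>The bound N + 15 comes from \<open>adm_mem\<close>. Admissible sets at n lie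
    below n, so only finitely many monomials remain.\<close>
  define F where "F = (\<lambda>(S, n). mat (xm S * vv n) :: 'a endo) ` (Pow {..<N + 15} \<times> {..<N + 15})"
  have "E \<in> endo.span (I \<union> F)" if "E \<in> Qalg" for E :: "'a endo"
  proof -
    obtain a where a: "a \<in> filt 0" "E = mat a" using Qalg_filt \<open>E \<in> Qalg\<close> by blast
    from a(1) have "mat a \<in> endo.span (I \<union> F)"
    proof (induction rule: filt_induct)
      case zero
      then show ?case unfolding zero_op.rep_eq by (rule endo.span_zero)
    next
      case (gen c S n b)
      have "mat (xm S * vv n :: 'a op) \<in> I \<union> F"
      proof (cases "N + 15 \<le> n")
        case True
        then show ?thesis using adm_mem[OF N True gen(2)] by simp
      next
        case False
        then have "(S, n) \<in> Pow {..<N + 15} \<times> {..<N + 15}" using gen(2) by (fastforce simp: adm_def)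
        then have "mat (xm S * vv n :: 'a op) \<in> F" unfolding F_def by (rule rev_image_eqI) simp
        then show ?thesis by blast
      qed
      then show ?case
        unfolding plus_op.rep_eq scl.rep_eq
        by (intro endo.span_add endo.span_scale gen) (rule endo.span_base)
    qed
    then show ?thesis by (simp add: a)
  qed
  moreover have "finite F" by (simp add: F_def)
  ultimately show ?thesis unfolding fin_codim_def by blast
qed

section \<open>Infinite dimension of Q\<close>

lemma mat_lx_times_empty: "mat (lx i * a) S {||} = 0"
  unfolding mat_times by (rule sum.neutral) (auto simp: mat_lx)

text \<open>The constant term of v_m(x_n) sees only the derivation part of v_m, because the rest is
  a left multiple of x_m.\<close>

lemma mat_vv_singleton: "mat (vv m) {|n|} {||} = (if m = n then 1 else 0 :: 'a::field)"
proof -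
  consider "m \<le> n" | "n < m" by linarith
  then show ?thesis
  proof cases
    case 1
    have "mat (lx m * lx (m + 1) * vv (m + 3)) {|n|} {||} = (0 :: 'a)"
      using mat_lx_times_empty by (simp add: mult.assoc)
    moreover have "sg n {|n|} = (1 :: 'a)"
    proof -
      have "{s. s |\<in>| {|n|} \<and> s < n} = {}" by auto
      then show ?thesis by (simp only: sg_def card.empty power_0)
    qed
    ultimately show ?thesis by (subst vv_rec) (auto simp: mat_dd)
  next
    case 2
    then show ?thesis using vv_kills[of "{|n|}" m] by auto
  qed
qed

lemma Qalg_infinite_dim: "infinite_dim (Qalg :: 'a::field endo set)"
  unfolding infinite_dim_def
proof
  assume "\<exists>F. finite F \<and> (Qalg :: 'a endo set) \<subseteq> endo.span F"
  then obtain F where F: "finite F" "(Qalg :: 'a endo set) \<subseteq> endo.span F" by blast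
  let ?B = "range (\<lambda>n. mat (vv n) :: 'a endo)"
  have inj: "inj (\<lambda>n. mat (vv n) :: 'a endo)"
    by (rule injI) (metis mat_vv_singleton zero_neq_one)
  have "endo.independent ?B"
    unfolding endo.dependent_explicit
  proof
    assume "\<exists>t u. finite t \<and> t \<subseteq> ?B \<and> (\<Sum>E\<in>t. escale (u E) E) = 0 \<and> (\<exists>E\<in>t. u E \<noteq> 0)"
    then obtain t u n where t: "finite t" "t \<subseteq> ?B" "(\<Sum>E\<in>t. escale (u E) E) = 0"
      and n: "mat (vv n) \<in> t" "u (mat (vv n)) \<noteq> 0" by blast
    have ev: "(\<Sum>E\<in>A. escale (u E) E) S T = (\<Sum>E\<in>A. u E * E S T)" for A S T
      by (induction A rule: infinite_finite_induct) (auto simp: escale_def)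
    \<comment> \<open>This matrix entry vanishes for every pivot other than v_n and isolates its
      coefficient.\<close>
    have "(\<Sum>E\<in>t. u E * E {|n|} {||}) = (\<Sum>E\<in>t. if E = mat (vv n) then u E else 0)"
    proof (rule sum.cong)
      fix E assume "E \<in> t"
      then obtain m where m: "E = mat (vv m)" using t by blast
      then have "E = mat (vv n) \<longleftrightarrow> m = n" using inj by (auto dest: injD)
      then show "u E * E {|n|} {||} = (if E = mat (vv n) then u E else 0)"
        by (simp add: m mat_vv_singleton)
    qed simp
    also have "\<dots> = u (mat (vv n))" using t n by simp
    finally show False using t n ev[of t "{|n|}" "{||}"] by simp
  qed
  moreover have "?B \<subseteq> endo.span F" using F vv_opQ by (auto simp: opQ_def)
  ultimately have "finite ?B" using endo.independent_span_bound[OF F(1)] by blast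
  then show False using inj finite_imageD by fastforce
qed

theorem theorem7p4:
  shows "infinite_dim (Qalg :: 'a::field endo set)
     \<and> (\<forall>I. is_ideal I \<and> I \<noteq> {0} \<longrightarrow> fin_codim I (Qalg :: 'a endo set))"
  using Qalg_infinite_dim ideal_fin_codim by blast

end
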